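(* For each $p\in\left(\frac Ns,\infty\right)$ the following hold: (i) $\Lambda_1(p)>0$; (ii) there exists $(u_p,v_p)\in X^*_{s,t,p}(\Omega)$ such that $u_p>0$, $v_p>0$ in $\Omega$, $|u_p(x_1)|^{\alpha(p)}|v_p(x_2)|^{\beta(p)}=1$ and $\Lambda_1(p)=Q_{s,t,p}(u_p,v_p)$.
   Context: Let $\Omega\subset\mathbb{R}^N$ be a bounded, smooth domain, $0<s\le t<1$, and let $x_1,x_2\in\Omega$ be arbitrary points with $x_1\ne x_2$. Let $\alpha,\beta\colon\left(\frac{N}{s},\infty\right)\to(1,\infty)$ satisfy $\alpha(p)+\beta(p)=p$ for all $p\in\left(\frac{N}{s},\infty\right)$ and $\lim_{p\to\infty}\alpha(p)/p=\theta\in(0,1)$. For $0<r<1$ and $1\le p<\infty$ let $[u]_{r,p}^p=\int_{\mathbb{R}^N}\int_{\mathbb{R}^N}\frac{|u(x)-u(y)|^p}{|x-y|^{N+rp}}\,dx\,dy$ and $W^{r,p}_0(\Omega)=\{u\in L^p(\mathbb{R}^N): u=0 \text{ in }\mathbb{R}^N\setminus\Omega,\ [u]_{r,p}<\infty\}$. For $p>N/s$ the elements of $W^{s,p}_0(\Omega)$ and $W^{t,p}_0(\Omega)$ are identified with their continuous representatives. Put $X_{s,t,p}(\Omega)=W^{s,p}_0(\Omega)\times W^{t,p}_0(\Omega)$ and $X^*_{s,t,p}(\Omega)=\{(u,v)\in X_{s,t,p}(\Omega):u(x_1)v(x_2)\ne0\}$. For $p\in\left(\frac{N}{s},\infty\right)$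 and $(u,v)\in X^*_{s,t,p}(\Omega)$ define $$Q_{s,t,p}(u,v)=\frac{\frac1p[u]_{s,p}^p+\frac1p[v]_{t,p}^p}{|u(x_1)|^{\alpha(p)}|v(x_2)|^{\beta(p)}},\qquad\Lambda_1(p)=\inf_{(u,v)\in X^*_{s,t,p}(\Omega)}Q_{s,t,p}(u,v).$$ *)

theory Defs
  imports "HOL-Analysis.Analysis"
begin

primrec C_diff :: "nat \<Rightarrow> ('a::euclidean_space \<Rightarrow> real) \<Rightarrow> bool" where
  "C_diff 0 f \<longleftrightarrow> continuous_on UNIV f"
| "C_diff (Suc k) f \<longleftrightarrow> (\<forall>x. f differentiable (at x)) \<and>
     (\<forall>b\<in>Basis. C_diff k (\<lambda>x. frechet_derivative f (at x) b))"

definition smooth_fun :: "('a::euclidean_space \<Rightarrow> real) \<Rightarrow> bool" where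
  "smooth_fun f \<longleftrightarrow> (\<forall>k. C_diff k f)"

text \<open>
  Near each boundary point the domain is, after a rotation of the axes, the region above
  the graph of a smooth function of \<open>N - 1\<close> variables. The unit vector \<open>e\<close> is the
  direction of the last axis, and \<open>\<gamma>\<close> is only evaluated on the hyperplane orthogonal
  to \<open>e\<close>; every smooth function on that hyperplane is the restriction of a
  smooth function on the whole space.
\<close>

definition smooth_bounded_domain :: "'a::euclidean_space set \<Rightarrow> bool" where
  "smooth_bounded_domain \<Omega> \<longleftrightarrow>
     open \<Omega> \<and> connected \<Omega> \<and> \<Omega> \<noteq> {} \<and> bounded \<Omega> \<and>
     (\<forall>x0\<in>frontier \<Omega>. \<exists>r>0. \<exists>e \<gamma>. norm e = 1 \<and> smooth_fun \<gamma> \<and>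
        \<Omega> \<inter> ball x0 r = {x \<in> ball x0 r. \<gamma> (x - (x \<bullet> e) *\<^sub>R e) < x \<bullet> e})"

text \<open>
  The \<open>p\<close>-th power of the Gagliardo seminorm, with values in \<open>[0, \<infinity>]\<close>. On the diagonal
  the integrand is \<open>0 / 0 = 0\<close>.
\<close>

definition gagliardo_pow :: "real \<Rightarrow> real \<Rightarrow> ('a::euclidean_space \<Rightarrow> real) \<Rightarrow> ennreal" where
  "gagliardo_pow r p u =
     (\<integral>\<^sup>+x. (\<integral>\<^sup>+y. ennreal (\<bar>u x - u y\<bar> powr p / norm (x - y) powr (real DIM('a) + r * p))
        \<partial>lborel) \<partial>lborel)"

definition frac_sobolev0 :: "real \<Rightarrow> real \<Rightarrow> 'a::euclidean_space set \<Rightarrow> ('a \<Rightarrow> real) set" where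
  "frac_sobolev0 r p \<Omega> = {u. u \<in> borel_measurable lborel \<and>
     integrable lborel (\<lambda>x. \<bar>u x\<bar> powr p) \<and>
     (AE x in lborel. x \<notin> \<Omega> \<longrightarrow> u x = 0) \<and>
     gagliardo_pow r p u < \<infinity>}"

text \<open>
  Two continuous functions that agree almost everywhere are equal, so the continuous members
  of \<^const>\<open>frac_sobolev0\<close> are the continuous representatives of its almost-everywhere classes.
\<close>

definition frac_sobolev0_cont :: "real \<Rightarrow> real \<Rightarrow> 'a::euclidean_space set \<Rightarrow> ('a \<Rightarrow> real) set" where
  "frac_sobolev0_cont r p \<Omega> = {u \<in> frac_sobolev0 r p \<Omega>. continuous_on UNIV u}"

definition X_space :: "real \<Rightarrow> real \<Rightarrow> real \<Rightarrow> 'a::euclidean_space set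
    \<Rightarrow> (('a \<Rightarrow> real) \<times> ('a \<Rightarrow> real)) set" where
  "X_space s t p \<Omega> = frac_sobolev0_cont s p \<Omega> \<times> frac_sobolev0_cont t p \<Omega>"

definition X_star :: "real \<Rightarrow> real \<Rightarrow> real \<Rightarrow> 'a::euclidean_space set \<Rightarrow> 'a \<Rightarrow> 'a
    \<Rightarrow> (('a \<Rightarrow> real) \<times> ('a \<Rightarrow> real)) set" where
  "X_star s t p \<Omega> x1 x2 = {(u, v) \<in> X_space s t p \<Omega>. u x1 * v x2 \<noteq> 0}"

definition Q_quot :: "real \<Rightarrow> real \<Rightarrow> (real \<Rightarrow> real) \<Rightarrow> (real \<Rightarrow> real) \<Rightarrow> 'a \<Rightarrow> 'a
    \<Rightarrow> real \<Rightarrow> ('a::euclidean_space \<Rightarrow> real) \<Rightarrow> ('a \<Rightarrow> real) \<Rightarrow> real" where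
  "Q_quot s t \<alpha> \<beta> x1 x2 p u v =
     (1 / p * enn2real (gagliardo_pow s p u) + 1 / p * enn2real (gagliardo_pow t p v)) /
     (\<bar>u x1\<bar> powr \<alpha> p * \<bar>v x2\<bar> powr \<beta> p)"

definition Lambda1 :: "real \<Rightarrow> real \<Rightarrow> 'a::euclidean_space set \<Rightarrow> (real \<Rightarrow> real) \<Rightarrow> (real \<Rightarrow> real)
    \<Rightarrow> 'a \<Rightarrow> 'a \<Rightarrow> real \<Rightarrow> real" where
  "Lambda1 s t \<Omega> \<alpha> \<beta> x1 x2 p =
     (INF (u, v)\<in>X_star s t p \<Omega> x1 x2. Q_quot s t \<alpha> \<beta> x1 x2 p u v)"

end

theory Submission
  imports Defs "HOL-Complex_Analysis.Great_Picard"
begin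

text \<open>
  Existence is the direct method. The quotient is invariant under a common scaling of \<open>u\<close> and
  \<open>v\<close>, so a minimizing sequence may be taken with denominator \<open>1\<close> and bounded energies. As
  \<open>p > N / s\<close>, Morrey's inequality makes it equicontinuous, Arzela-Ascoli and Fatou produce a
  minimizer, and absolute values make it nonnegative. Its energy is positive because a
  function of zero energy is constant, again by Morrey's inequality.

  For strict positivity suppose that \<open>u x0 = 0\<close>, and let \<open>w = max u (\<epsilon> \<phi>)\<close> with \<open>\<phi>\<close> a small
  truncated paraboloid centred at \<open>x0\<close> that vanishes near \<open>x1\<close>. By convexity the energy grows from
  \<open>u\<close> to \<open>w\<close> by at most the first variation at \<open>w\<close> in direction \<open>w - u\<close>. There the fractional
  \<open>p\<close>-Laplacian of \<open>w\<close> is at most \<open>O(\<epsilon>\<^sup>p\<^sup>-\<^sup>1)\<close>, coming from \<open>\<phi>\<close>, minus a fixed amount coming from the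
  ball around \<open>x1\<close> on which \<open>u\<close> is bounded below. For small \<open>\<epsilon>\<close> the energy strictly decreases, which
  contradicts minimality.
\<close>

section \<open>Signed powers\<close>

text \<open>Once \<open>u x1\<close> and \<open>v x2\<close> are fixed, the denominator is frozen
  and the numerator is a sum, so a minimizing pair minimizes each seminorm separately and positivity
  concerns one function at a time. The obstacle there is the singular kernel: for a function known
  only to be continuous with finite energy, the fractional p-Laplacian need not exist pointwise.
  This is why the tangent is taken at w and not at u: wherever w > u, w coincides with
  \<epsilon>\<phi>, and w >= \<epsilon>\<phi> everywhere, so monotonicity of the signed power bounds
  the operator at w by the one at the explicit function \<epsilon>\<phi>. Pointwise integrals are
  formed with a kernel cut off near 0 and bounded independently of the cut. The conditions
  \<open>1 < \<alpha> p\<close> and \<open>1 < \<beta> p\<close> enter through their consequence p >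
  2, which makes the signed power of exponent p - 1 locally Lipschitz. Morrey's inequality appears
  in an inhomogeneous form, linear in 1 plus the energy; homogeneity is exploited by rescaling the
  function.\<close>

definition spow :: "real \<Rightarrow> real \<Rightarrow> real" where
  "spow q a = sgn a * \<bar>a\<bar> powr q"

lemma spow_minus: "spow q (- a) = - spow q a"
  by (simp add: spow_def sgn_minus)

lemma spow_mono:
  assumes "0 \<le> q" "a \<le> b"
  shows "spow q a \<le> spow q b"
  using assms by (cases a "0::real" rule: linorder_cases; cases b "0::real" rule: linorder_cases)
    (auto simp: spow_def intro: powr_mono2 order_trans[of _ 0])

lemma abs_spow_le:
  assumes "0 \<le> q" "\<bar>a\<bar> \<le> M"
  shows "\<bar>spow q a\<bar> \<le> M powr q"
  using assms by (auto simp: spow_def abs_mult sgn_if intro: powr_mono2)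

lemma spow_mult: "0 \<le> c \<Longrightarrow> spow q (c * a) = c powr q * spow q a"
  by (cases "c = 0") (auto simp: spow_def sgn_mult abs_mult powr_mult)

lemma borel_measurable_spow [measurable]: "spow q \<in> borel_measurable borel"
  unfolding spow_def[abs_def] by measurable

text \<open>Young's inequality for the product of \<open>a powr (q - 1)\<close> and
  \<open>b\<close>, with exponents \<open>q / (q - 1)\<close> and \<open>q\<close>, is already the
  tangent inequality; no derivative is taken, so the endpoint 0 is covered.\<close>

lemma powr_tangent_le:
  fixes a b q :: real
  assumes "1 < q" "0 \<le> a" "0 \<le> b"
  shows "a powr q + q * a powr (q - 1) * (b - a) \<le> b powr q"
proof -
  have "a powr (q - 1) * b \<le> (a powr (q - 1)) powr (q / (q - 1)) / (q / (q - 1)) + b powr q / q"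
    using assms by (intro Youngs_inequality) (auto simp: field_simps)
  also have "(a powr (q - 1)) powr (q / (q - 1)) = a powr q"
    using assms by (simp add: powr_powr)
  finally have "q * (a powr (q - 1) * b) \<le> (q - 1) * a powr q + b powr q"
    using assms by (simp add: field_simps)
  moreover have "a powr (q - 1) * a = a powr q"
    using assms powr_add[of a "q - 1" 1] by (cases "a = 0") auto
  ultimately show ?thesis by (simp add: algebra_simps)
qed

text \<open>\<open>q * spow (q - 1) a\<close> is the slope at a of the even convex function |.|^q.
  Since sgn a * b <= |b|, the inequality reduces to nonnegative arguments.\<close>

lemma powr_abs_tangent_le:
  fixes a b q :: real
  assumes "1 < q"
  shows "\<bar>a\<bar> powr q \<le> \<bar>b\<bar> powr q + q * (spow (q - 1) a * (a - b))"
proof -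
  have "q * \<bar>a\<bar> powr (q - 1) * (\<bar>a\<bar> - \<bar>b\<bar>) \<le> q * (spow (q - 1) a * (a - b))"
  proof -
    have "sgn a * b \<le> \<bar>b\<bar>" by (auto simp: sgn_if)
    hence "\<bar>a\<bar> - \<bar>b\<bar> \<le> sgn a * (a - b)"
      by (simp add: algebra_simps sgn_if abs_if split: if_splits)
    hence "(q * \<bar>a\<bar> powr (q - 1)) * (\<bar>a\<bar> - \<bar>b\<bar>) \<le> (q * \<bar>a\<bar> powr (q - 1)) * (sgn a * (a - b))"
      using assms by (intro mult_left_mono) auto
    thus ?thesis by (simp add: spow_def mult_ac)
  qed
  with powr_tangent_le[of q "\<bar>a\<bar>" "\<bar>b\<bar>"] assms show ?thesis
    by (simp add: algebra_simps)
qed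

text \<open>Weighted with the kernel, the right-hand side becomes a combination of two energy
  densities. This is the integrable majorant that allows the cut-off to be removed from the first
  variation.\<close>

lemma abs_spow_mult_diff_le:
  assumes "1 < q"
  shows "\<bar>spow (q - 1) a * (a - b)\<bar> \<le> 2 * \<bar>a\<bar> powr q + \<bar>b\<bar> powr q"
proof -
  have e: "x powr (q - 1) * x = x powr q" if "0 \<le> x" for x :: real
    using that assms powr_add[of x "q - 1" 1] by (cases "x = 0") auto
  have "\<bar>spow (q - 1) a * (a - b)\<bar> \<le> \<bar>a\<bar> powr (q - 1) * (\<bar>a\<bar> + \<bar>b\<bar>)"
    unfolding abs_mult using assms by (intro mult_mono abs_spow_le) auto
  also have "\<dots> = \<bar>a\<bar> powr q + \<bar>a\<bar> powr (q - 1) * \<bar>b\<bar>"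
    by (simp add: distrib_left e)
  also have "\<bar>a\<bar> powr (q - 1) * \<bar>b\<bar> \<le> max \<bar>a\<bar> \<bar>b\<bar> powr (q - 1) * max \<bar>a\<bar> \<bar>b\<bar>"
    using assms by (intro mult_mono powr_mono2) auto
  also have "\<dots> = max \<bar>a\<bar> \<bar>b\<bar> powr q" by (rule e) auto
  also have "\<dots> \<le> \<bar>a\<bar> powr q + \<bar>b\<bar> powr q" by (simp add: max_def)
  finally show ?thesis by simp
qed

text \<open>Only an upper bound on a + b is available. If a and b nearly cancel, so do their signed
  powers, because \<open>spow\<close> is odd and Lipschitz on [-M, M] for q > 1. It is meant for the
  two increments of a second difference, with q = p - 1.\<close>

lemma spow_add_le:
  assumes q: "1 < q" and M: "\<bar>a\<bar> \<le> M" "\<bar>b\<bar> \<le> M" and c: "a + b \<le> c" "0 \<le> c"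
  shows "spow q a + spow q b \<le> q * M powr (q - 1) * c"
proof -
  \<comment> \<open>The claim is symmetric in a and b, so the larger one may be called a.\<close>
  have *: "spow q a + spow q b \<le> q * M powr (q - 1) * c"
    if "\<bar>a\<bar> \<le> M" "\<bar>b\<bar> \<le> M" "a + b \<le> c" "b \<le> a" for a b
  proof (cases "a + b \<le> 0")
    case True
    then have "spow q a \<le> spow q (- b)" using q by (intro spow_mono) auto
    moreover have "0 \<le> q * M powr (q - 1) * c" using q c by simp
    ultimately show ?thesis by (simp add: spow_minus)
  next
    case False
    have a0: "0 < a" using False that by linarith
    have Mp: "a powr (q - 1) \<le> M powr (q - 1)" using a0 that q by (intro powr_mono2) auto
    have e: "x powr (q - 1) * x = x powr q" if "0 \<le> x" for x :: real
      using that q powr_add[of x "q - 1" 1] by (cases "x = 0") auto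
    have fin: "q * a powr (q - 1) * (a + b) \<le> q * M powr (q - 1) * c"
      using False that q c Mp by (intro mult_mono) auto
    show ?thesis
    proof (cases "b \<le> 0")
      case True
      have "spow q a + spow q b = a powr q - (- b) powr q"
        using a0 True by (auto simp: spow_def sgn_if)
      \<comment> \<open>The tangent at a, evaluated at the point -b.\<close>
      also have "\<dots> \<le> q * a powr (q - 1) * (a + b)"
        using powr_tangent_le[of q a "- b"] a0 True q by (simp add: algebra_simps)
      finally show ?thesis using fin by linarith
    next
      case b: False
      have "b powr q \<le> a powr (q - 1) * b"
        using b that q a0 by (subst e[symmetric]) (auto intro!: mult_right_mono powr_mono2)
      then have "spow q a + spow q b \<le> a powr (q - 1) * (a + b)"
        using a0 b e[of a] by (simp add: spow_def distrib_left)
      also have "\<dots> \<le> q * (a powr (q - 1) * (a + b))"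
        using q False mult_right_mono[of 1 q "a powr (q - 1) * (a + b)"] by simp
      finally show ?thesis using fin by (simp add: mult.assoc)
    qed
  qed
  show ?thesis
    using *[of a b] *[of b a] M c by (cases "b \<le> a") (auto simp: add.commute)
qed

section \<open>The capped Gagliardo kernel\<close>

lemma nn_integral_lborel_translate:
  fixes f :: "'a::euclidean_space \<Rightarrow> ennreal"
  assumes [measurable]: "f \<in> borel_measurable borel"
  shows "(\<integral>\<^sup>+y. f (a + y) \<partial>lborel) = (\<integral>\<^sup>+y. f y \<partial>lborel)"
proof -
  have "(\<integral>\<^sup>+y. f y \<partial>lborel) = (\<integral>\<^sup>+y. f y \<partial>distr lborel borel ((+) a))"
    by (simp add: lborel_distr_plus)
  thus ?thesis by (simp add: nn_integral_distr)
qed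

lemma lborel_distr_reflect:
  fixes a :: "'a::euclidean_space"
  shows "distr lborel borel (\<lambda>y. a - y) = lborel"
  by (subst lborel_affine[of "-1" a]) (auto simp: density_1)

lemma nn_integral_lborel_reflect:
  fixes f :: "'a::euclidean_space \<Rightarrow> ennreal"
  assumes [measurable]: "f \<in> borel_measurable borel"
  shows "(\<integral>\<^sup>+y. f (a - y) \<partial>lborel) = (\<integral>\<^sup>+y. f y \<partial>lborel)"
proof -
  have "(\<integral>\<^sup>+y. f y \<partial>lborel) = (\<integral>\<^sup>+y. f y \<partial>distr lborel borel (\<lambda>y. a - y))"
    by (simp add: lborel_distr_reflect)
  thus ?thesis by (simp add: nn_integral_distr)
qed

lemma integral_lborel_translate:
  fixes f :: "'a::euclidean_space \<Rightarrow> real"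
  assumes [measurable]: "f \<in> borel_measurable borel"
  shows "(\<integral>y. f (a + y) \<partial>lborel) = (\<integral>y. f y \<partial>lborel)"
proof -
  have "(\<integral>y. f y \<partial>lborel) = (\<integral>y. f y \<partial>distr lborel borel ((+) a))"
    by (simp add: lborel_distr_plus)
  thus ?thesis by (simp add: integral_distr)
qed

lemma integral_lborel_reflect:
  fixes f :: "'a::euclidean_space \<Rightarrow> real"
  assumes [measurable]: "f \<in> borel_measurable borel"
  shows "(\<integral>y. f (a - y) \<partial>lborel) = (\<integral>y. f y \<partial>lborel)"
proof -
  have "(\<integral>y. f y \<partial>lborel) = (\<integral>y. f y \<partial>distr lborel borel (\<lambda>y. a - y))"
    by (simp add: lborel_distr_reflect)
  thus ?thesis by (simp add: integral_distr)
qed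

text \<open>For a function whose increments are at most M and at most M |x - y|, the energy density
  is at most M^p times this kernel at x - y. The factor |z|^p makes it integrable at 0 because
  \<sigma> < 1, the cap 1 makes it integrable at infinity because \<sigma> > 0.\<close>

definition capped_kernel :: "real \<Rightarrow> real \<Rightarrow> 'a::euclidean_space \<Rightarrow> real" where
  "capped_kernel \<sigma> p z = min 1 (norm z powr p) / norm z powr (real DIM('a) + \<sigma> * p)"

lemma capped_kernel_nonneg: "0 \<le> capped_kernel \<sigma> p z"
  by (simp add: capped_kernel_def)

lemma borel_measurable_capped_kernel [measurable]:
  "capped_kernel \<sigma> p \<in> borel_measurable borel"
  unfolding capped_kernel_def[abs_def] by measurable

lemma ball_in_sets_borel [measurable]: "ball a r \<in> sets (borel :: 'a::metric_space measure)"
  by simp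

lemma suminf_geometric_finite:
  assumes "0 \<le> c" "0 \<le> q" "q < 1"
  shows "(\<Sum>j. ennreal (c * q ^ j)) < \<infinity>"
proof -
  have "summable (\<lambda>j. c * q ^ j)" using assms by (intro summable_mult summable_geometric) auto
  then show ?thesis
    using assms by (subst suminf_ennreal_eq[OF _ summable_sums]) auto
qed

text \<open>Ball volumes are a constant times r^N, so integrating term by term leaves a convergent
  geometric series.\<close>

lemma nn_integral_dyadic_finite:
  fixes r :: "nat \<Rightarrow> real"
  assumes "\<And>j. 0 \<le> d j" "\<And>j. 0 \<le> r j" "0 \<le> c" "0 \<le> q" "q < 1"
    and "\<And>j. d j * r j ^ DIM('a) \<le> c * q ^ j"
  shows "(\<integral>\<^sup>+(z::'a::euclidean_space). (\<Sum>j. ennreal (d j) * indicator (ball 0 (r j)) z) \<partial>lborel) < \<infinity>"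
proof -
  have "(\<integral>\<^sup>+(z::'a). (\<Sum>j. ennreal (d j) * indicator (ball 0 (r j)) z) \<partial>lborel)
      = (\<Sum>j. ennreal (d j) * emeasure lborel (ball (0::'a) (r j)))"
    by (subst nn_integral_suminf, measurable) (auto intro!: suminf_cong nn_integral_cmult_indicator)
  also have "\<dots> \<le> (\<Sum>j. ennreal (unit_ball_vol (real DIM('a)) * c * q ^ j))"
  proof (intro suminf_le allI)
    fix j
    have "ennreal (d j) * emeasure lborel (ball (0::'a) (r j))
        = ennreal (d j * (unit_ball_vol (real DIM('a)) * r j ^ DIM('a)))"
      using assms by (simp add: emeasure_ball ennreal_mult)
    also have "\<dots> \<le> ennreal (unit_ball_vol (real DIM('a)) * c * q ^ j)"
      using mult_left_mono[OF assms(6)[of j], of "unit_ball_vol (real DIM('a))"]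
      by (intro ennreal_leI) (simp add: mult_ac)
    finally show "ennreal (d j) * emeasure lborel (ball (0::'a) (r j)) \<le> \<dots>" .
  qed auto
  also have "\<dots> < \<infinity>"
    using assms by (intro suminf_geometric_finite) auto
  finally show ?thesis .
qed

lemma two_powr_minus_nat: "(2::real) powr (- (real j * a)) = (2 powr (- a)) ^ j"
  by (simp add: powr_realpow[symmetric] powr_powr mult.commute)

text \<open>Dyadic shells: 2^-(j+1) <= |z| < 2^-j inside the unit ball, 2^j <= |z| < 2^(j+1)
  outside. Each shell is enlarged to the ball of its outer radius \<open>r1 j\<close> or
  \<open>r2 j\<close>, and \<open>d1 j\<close> or \<open>d2 j\<close> bounds the kernel on the
  shell. The ratios of the two series are 2^(-(1-\<sigma>)p) and 2^(-\<sigma>p).\<close>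

lemma nn_integral_capped_kernel_finite:
  assumes "0 < \<sigma>" "\<sigma> < 1" "0 < p"
  shows "(\<integral>\<^sup>+(z::'a::euclidean_space). ennreal (capped_kernel \<sigma> p z) \<partial>lborel) < \<infinity>"
proof -
  let ?N = "real DIM('a)"
  let ?A = "?N + \<sigma> * p"
  define d1 where "d1 j = 2 powr (- (real j * p)) * 2 powr ((real j + 1) * ?A)" for j
  define d2 where "d2 j = 2 powr (- (real j * ?A))" for j
  define r1 where "r1 j = 2 powr (- real j)" for j
  define r2 where "r2 j = 2 powr (real j + 1)" for j
  have [simp]: "0 \<le> d1 j" "0 \<le> d2 j" "0 \<le> r1 j" "0 \<le> r2 j" for j
    by (auto simp: d1_def d2_def r1_def r2_def)
  let ?S1 = "\<lambda>z::'a. (\<Sum>j. ennreal (d1 j) * indicator (ball 0 (r1 j)) z)"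
  let ?S2 = "\<lambda>z::'a. (\<Sum>j. ennreal (d2 j) * indicator (ball 0 (r2 j)) z)"
  have A: "0 < ?A" using assms by (simp add: add_pos_pos)
  have f1: "(\<integral>\<^sup>+z. ?S1 z \<partial>lborel) < \<infinity>"
  proof (rule nn_integral_dyadic_finite[where c="2 powr ?A" and q="2 powr (- (p - \<sigma> * p))"])
    show "2 powr - (p - \<sigma> * p) < 1"
    proof -
      have "0 < (1 - \<sigma>) * p" using assms by simp
      then show ?thesis by (simp add: powr_less_one algebra_simps)
    qed
    fix j
    have "r1 j ^ DIM('a) = 2 powr (- (real j * ?N))"
      by (simp add: r1_def powr_realpow[symmetric] powr_powr)
    then have "d1 j * r1 j ^ DIM('a) = 2 powr (?A + (- (real j * (p - \<sigma> * p))))"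
      by (simp add: d1_def powr_add[symmetric] algebra_simps)
    also have "\<dots> = 2 powr ?A * (2 powr (- (p - \<sigma> * p))) ^ j"
      by (simp only: powr_add two_powr_minus_nat)
    finally show "d1 j * r1 j ^ DIM('a) \<le> 2 powr ?A * (2 powr (- (p - \<sigma> * p))) ^ j" by simp
  qed auto
  have f2: "(\<integral>\<^sup>+z. ?S2 z \<partial>lborel) < \<infinity>"
  proof (rule nn_integral_dyadic_finite[where c="2 powr ?N" and q="2 powr (- (\<sigma> * p))"])
    show "2 powr - (\<sigma> * p) < 1" using assms by (simp add: powr_less_one)
    fix j
    have "r2 j ^ DIM('a) = 2 powr ((real j + 1) * ?N)"
      by (simp add: r2_def powr_realpow[symmetric] powr_powr)
    then have "d2 j * r2 j ^ DIM('a) = 2 powr (?N + (- (real j * (\<sigma> * p))))"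
      by (simp add: d2_def powr_add[symmetric] algebra_simps)
    also have "\<dots> = 2 powr ?N * (2 powr (- (\<sigma> * p))) ^ j"
      by (simp only: powr_add two_powr_minus_nat)
    finally show "d2 j * r2 j ^ DIM('a) \<le> 2 powr ?N * (2 powr (- (\<sigma> * p))) ^ j" by simp
  qed auto
  have term_le: "f j \<le> (\<Sum>j. f j)" for f :: "nat \<Rightarrow> ennreal" and j
    using sum_le_suminf[of f "{j}"] by simp
  have le: "ennreal (capped_kernel \<sigma> p z) \<le> ?S1 z + ?S2 z" for z :: 'a
  proof (cases "z = 0")
    case True
    then show ?thesis by (simp add: capped_kernel_def)
  next
    case z: False
    show ?thesis
    proof (cases "norm z < 1")
      case True
      \<comment> \<open>Ceiling minus one, not the floor: the balls are open, so
        \<open>norm z < r1 j\<close> has to be strict even if |z| is a power of two.\<close>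
      define j where "j = nat (\<lceil>- log 2 (norm z)\<rceil> - 1)"
      have lz: "- log 2 (norm z) > 0" using True z by simp
      then have ce: "\<lceil>- log 2 (norm z)\<rceil> \<ge> 1" by linarith
      have j: "real j = real_of_int \<lceil>- log 2 (norm z)\<rceil> - 1" using ce by (simp add: j_def)
      have up: "log 2 (norm z) < - real j" using j by linarith
      have lo: "- (real j + 1) \<le> log 2 (norm z)" using j by linarith
      have nz: "norm z = 2 powr (log 2 (norm z))" using z by simp
      have "norm z < r1 j" unfolding r1_def by (subst nz) (use up in simp)
      then have "z \<in> ball 0 (r1 j)" by simp
      moreover have "capped_kernel \<sigma> p z \<le> d1 j"
      proof -
        have "min 1 (norm z powr p) \<le> 2 powr (- (real j * p))"
        proof -
          have "norm z powr p \<le> (r1 j) powr p" using \<open>norm z < r1 j\<close> assms by (intro powr_mono2) auto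
          also have "\<dots> = 2 powr (- (real j * p))" by (simp add: r1_def powr_powr)
          finally show ?thesis by simp
        qed
        moreover have "1 / norm z powr ?A \<le> 2 powr ((real j + 1) * ?A)"
        proof -
          have "1 / norm z powr ?A = 2 powr (- log 2 (norm z) * ?A)"
            by (subst nz) (simp add: powr_powr powr_minus divide_inverse)
          also have "\<dots> \<le> 2 powr ((real j + 1) * ?A)"
            using lo A by (intro powr_mono mult_right_mono) auto
          finally show ?thesis .
        qed
        ultimately have "min 1 (norm z powr p) * (1 / norm z powr ?A) \<le> d1 j"
          unfolding d1_def by (intro mult_mono) auto
        then show ?thesis by (simp add: capped_kernel_def)
      qed
      ultimately have "ennreal (capped_kernel \<sigma> p z) \<le> ennreal (d1 j) * indicator (ball 0 (r1 j)) z"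
        by (simp add: ennreal_leI)
      also have "\<dots> \<le> ?S1 z" by (rule term_le)
      finally show ?thesis by (simp add: add_increasing2)
    next
      case False
      define j where "j = nat \<lfloor>log 2 (norm z)\<rfloor>"
      have "log 2 (norm z) \<ge> 0" using False z by (subst zero_le_log_cancel_iff) auto
      then have j: "real j = real_of_int \<lfloor>log 2 (norm z)\<rfloor>" by (simp add: j_def)
      have up: "log 2 (norm z) < real j + 1" and lo: "real j \<le> log 2 (norm z)" using j by linarith+
      have nz: "norm z = 2 powr (log 2 (norm z))" using z by simp
      have "norm z < r2 j" unfolding r2_def by (subst nz) (use up in simp)
      then have "z \<in> ball 0 (r2 j)" by simp
      moreover have "capped_kernel \<sigma> p z \<le> d2 j"
      proof -
        have "1 / norm z powr ?A = 2 powr (- log 2 (norm z) * ?A)"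
          by (subst nz) (simp add: powr_powr powr_minus divide_inverse)
        also have "\<dots> \<le> d2 j"
          unfolding d2_def using lo A mult_right_mono[OF lo, of ?A] by (intro powr_mono) auto
        finally have "1 / norm z powr ?A \<le> d2 j" .
        moreover have "capped_kernel \<sigma> p z \<le> 1 / norm z powr ?A"
          unfolding capped_kernel_def by (intro divide_right_mono) auto
        ultimately show ?thesis by linarith
      qed
      ultimately have "ennreal (capped_kernel \<sigma> p z) \<le> ennreal (d2 j) * indicator (ball 0 (r2 j)) z"
        by (simp add: ennreal_leI)
      also have "\<dots> \<le> ?S2 z" by (rule term_le)
      finally show ?thesis by (simp add: add_increasing)
    qed
  qed
  have "(\<integral>\<^sup>+(z::'a). ennreal (capped_kernel \<sigma> p z) \<partial>lborel) \<le> (\<integral>\<^sup>+z. ?S1 z + ?S2 z \<partial>lborel)"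
    by (intro nn_integral_mono le)
  also have "\<dots> = (\<integral>\<^sup>+z. ?S1 z \<partial>lborel) + (\<integral>\<^sup>+z. ?S2 z \<partial>lborel)"
    by (intro nn_integral_add) measurable
  also have "\<dots> < \<infinity>" using f1 f2 by simp
  finally show ?thesis .
qed

section \<open>The Gagliardo seminorm\<close>

text \<open>The integrand as one function on the product space: finite energies become Bochner
  integrals, for which linearity, dominated convergence and the swap of x and y are at hand.\<close>

definition gagliardo_density :: "real \<Rightarrow> real \<Rightarrow> ('a::euclidean_space \<Rightarrow> real) \<Rightarrow> 'a \<times> 'a \<Rightarrow> real" where
  "gagliardo_density \<sigma> p u z =
     \<bar>u (fst z) - u (snd z)\<bar> powr p / norm (fst z - snd z) powr (real DIM('a) + \<sigma> * p)"

lemma gagliardo_density_nonneg: "0 \<le> gagliardo_density \<sigma> p u z"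
  by (simp add: gagliardo_density_def)

lemma borel_measurable_gagliardo_density [measurable]:
  assumes [measurable]: "u \<in> borel_measurable borel"
  shows "gagliardo_density \<sigma> p (u :: 'a::euclidean_space \<Rightarrow> real) \<in> borel_measurable (lborel \<Otimes>\<^sub>M lborel)"
  unfolding gagliardo_density_def[abs_def] by measurable

lemma gagliardo_pow_eq_nn_integral:
  fixes u :: "'a::euclidean_space \<Rightarrow> real"
  assumes [measurable]: "u \<in> borel_measurable borel"
  shows "gagliardo_pow \<sigma> p u = (\<integral>\<^sup>+z. ennreal (gagliardo_density \<sigma> p u z) \<partial>(lborel \<Otimes>\<^sub>M lborel))"
proof -
  have "(\<integral>\<^sup>+z. ennreal (gagliardo_density \<sigma> p u z) \<partial>(lborel \<Otimes>\<^sub>M lborel))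
      = (\<integral>\<^sup>+x. \<integral>\<^sup>+y. ennreal (gagliardo_density \<sigma> p u (x, y)) \<partial>lborel \<partial>lborel)"
    by (rule lborel.nn_integral_fst[symmetric]) measurable
  then show ?thesis by (simp add: gagliardo_pow_def gagliardo_density_def)
qed

lemma
  fixes u :: "'a::euclidean_space \<Rightarrow> real"
  assumes [measurable]: "u \<in> borel_measurable borel" and fin: "gagliardo_pow \<sigma> p u < \<infinity>"
  shows integrable_gagliardo_density: "integrable (lborel \<Otimes>\<^sub>M lborel) (gagliardo_density \<sigma> p u)"
    and integral_gagliardo_density:
      "(\<integral>z. gagliardo_density \<sigma> p u z \<partial>(lborel \<Otimes>\<^sub>M lborel)) = enn2real (gagliardo_pow \<sigma> p u)"
proof -
  show "integrable (lborel \<Otimes>\<^sub>M lborel) (gagliardo_density \<sigma> p u)"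
    using fin by (intro integrableI_bounded)
      (auto simp: gagliardo_pow_eq_nn_integral gagliardo_density_nonneg)
  show "(\<integral>z. gagliardo_density \<sigma> p u z \<partial>(lborel \<Otimes>\<^sub>M lborel)) = enn2real (gagliardo_pow \<sigma> p u)"
    by (subst integral_eq_nn_integral)
      (auto simp: gagliardo_pow_eq_nn_integral gagliardo_density_nonneg)
qed

lemma gagliardo_pow_mono:
  assumes "\<And>x y. \<bar>w x - w y\<bar> \<le> \<bar>u x - u y\<bar>" "0 \<le> p"
  shows "gagliardo_pow \<sigma> p w \<le> gagliardo_pow \<sigma> p u"
  unfolding gagliardo_pow_def using assms
  by (intro nn_integral_mono ennreal_leI divide_right_mono powr_mono2) auto

lemma gagliardo_pow_cmult:
  fixes u :: "'a::euclidean_space \<Rightarrow> real"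
  assumes [measurable]: "u \<in> borel_measurable borel"
  shows "gagliardo_pow \<sigma> p (\<lambda>x. c * u x) = ennreal (\<bar>c\<bar> powr p) * gagliardo_pow \<sigma> p u"
proof -
  have "gagliardo_density \<sigma> p (\<lambda>x. c * u x) z = \<bar>c\<bar> powr p * gagliardo_density \<sigma> p u z" for z
    by (simp add: gagliardo_density_def right_diff_distrib[symmetric] abs_mult powr_mult)
  then show ?thesis
    by (simp add: gagliardo_pow_eq_nn_integral gagliardo_density_nonneg ennreal_mult nn_integral_cmult)
qed

text \<open>The maximum is nonexpansive for the sup norm on pairs, and the p-th power of a maximum
  is at most the sum of the p-th powers.\<close>

lemma gagliardo_pow_max_finite:
  fixes u :: "'a::euclidean_space \<Rightarrow> real"
  assumes [measurable]: "u \<in> borel_measurable borel" "v \<in> borel_measurable borel"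
    and "gagliardo_pow \<sigma> p u < \<infinity>" "gagliardo_pow \<sigma> p v < \<infinity>" "0 \<le> p"
  shows "gagliardo_pow \<sigma> p (\<lambda>x. max (u x) (v x)) < \<infinity>"
proof -
  have le: "gagliardo_density \<sigma> p (\<lambda>x. max (u x) (v x)) z
      \<le> gagliardo_density \<sigma> p u z + gagliardo_density \<sigma> p v z" for z
  proof -
    let ?a = "\<bar>u (fst z) - u (snd z)\<bar>" and ?b = "\<bar>v (fst z) - v (snd z)\<bar>"
    have "\<bar>max (u (fst z)) (v (fst z)) - max (u (snd z)) (v (snd z))\<bar> powr p \<le> max ?a ?b powr p"
      using assms by (intro powr_mono2) auto
    also have "\<dots> \<le> ?a powr p + ?b powr p" by (simp add: max_def)
    finally show ?thesis
      unfolding gagliardo_density_def add_divide_distrib[symmetric] by (intro divide_right_mono) auto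
  qed
  have "gagliardo_pow \<sigma> p (\<lambda>x. max (u x) (v x)) \<le> gagliardo_pow \<sigma> p u + gagliardo_pow \<sigma> p v"
    by (subst (1 2 3) gagliardo_pow_eq_nn_integral, simp_all, subst nn_integral_add[symmetric])
      (auto intro!: nn_integral_mono simp: gagliardo_density_nonneg ennreal_plus[symmetric]
         simp del: ennreal_plus intro!: ennreal_leI le)
  also have "\<dots> < \<infinity>" using assms by simp
  finally show ?thesis .
qed

text \<open>The density vanishes unless x or y lies in the ball, and otherwise it is at most M^p
  times the capped kernel. Each alternative contributes at most M^p times the volume of the ball
  times the integral of that kernel.\<close>

lemma gagliardo_pow_lipschitz_finite:
  fixes u :: "'a::euclidean_space \<Rightarrow> real"
  assumes [measurable]: "u \<in> borel_measurable borel"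
    and bd: "\<And>x y. \<bar>u x - u y\<bar> \<le> M" and lip: "\<And>x y. \<bar>u x - u y\<bar> \<le> M * norm (x - y)"
    and supp: "\<And>x. x \<notin> ball a R \<Longrightarrow> u x = 0"
    and \<sigma>: "0 < \<sigma>" "\<sigma> < 1" "0 < p"
  shows "gagliardo_pow \<sigma> p u < \<infinity>"
proof -
  let ?B = "ball a R"
  let ?k = "\<lambda>z::'a. ennreal (capped_kernel \<sigma> p z)"
  let ?I = "\<integral>\<^sup>+z. ?k z \<partial>lborel"
  have M: "0 \<le> M" using bd[of 0 0] by simp
  have le: "ennreal (gagliardo_density \<sigma> p u (x, y))
      \<le> ennreal (M powr p) * (indicator ?B x * ?k (x - y)) + ennreal (M powr p) * (indicator ?B y * ?k (x - y))"
    for x y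
  proof (cases "x \<in> ?B \<or> y \<in> ?B")
    case True
    have "\<bar>u x - u y\<bar> powr p \<le> M powr p * min 1 (norm (x - y) powr p)"
    proof -
      have "\<bar>u x - u y\<bar> powr p \<le> M powr p" using bd \<sigma> by (intro powr_mono2) auto
      moreover have "\<bar>u x - u y\<bar> powr p \<le> (M * norm (x - y)) powr p"
        using lip \<sigma> by (intro powr_mono2) auto
      ultimately show ?thesis using M by (simp add: powr_mult min_def)
    qed
    then have "gagliardo_density \<sigma> p u (x, y) \<le> M powr p * capped_kernel \<sigma> p (x - y)"
      unfolding gagliardo_density_def capped_kernel_def by (simp add: divide_right_mono)
    then have "ennreal (gagliardo_density \<sigma> p u (x, y)) \<le> ennreal (M powr p) * ?k (x - y)"
      by (simp add: ennreal_mult[symmetric] capped_kernel_nonneg ennreal_leI)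
    with True show ?thesis
      by (auto simp: indicator_def intro: add_increasing2)
  next
    case False
    then show ?thesis using supp[of x] supp[of y] by (simp add: gagliardo_density_def)
  qed
  have I1: "(\<integral>\<^sup>+y. ?k (x - y) \<partial>lborel) = ?I" for x
    by (rule nn_integral_lborel_reflect) measurable
  have I2: "(\<integral>\<^sup>+x. ?k (x - y) \<partial>lborel) = ?I" for y
    using nn_integral_lborel_translate[of ?k "- y"] by (simp add: algebra_simps)
  have "gagliardo_pow \<sigma> p u = (\<integral>\<^sup>+x. \<integral>\<^sup>+y. ennreal (gagliardo_density \<sigma> p u (x, y)) \<partial>lborel \<partial>lborel)"
    by (simp add: gagliardo_pow_def gagliardo_density_def)
  also have "\<dots> \<le> (\<integral>\<^sup>+x. \<integral>\<^sup>+y. ennreal (M powr p) * (indicator ?B x * ?k (x - y)) + ennreal (M powr p) * (indicator ?B y * ?k (x - y)) \<partial>lborel \<partial>lborel)"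
    by (intro nn_integral_mono le)
  also have "\<dots> = (\<integral>\<^sup>+x. \<integral>\<^sup>+y. ennreal (M powr p) * (indicator ?B x * ?k (x - y)) \<partial>lborel \<partial>lborel)
      + (\<integral>\<^sup>+x. \<integral>\<^sup>+y. ennreal (M powr p) * (indicator ?B y * ?k (x - y)) \<partial>lborel \<partial>lborel)"
    by (simp add: nn_integral_add)
  \<comment> \<open>The order is exchanged so that the inner integral runs over the variable that is
    not confined to the ball.\<close>
  also have "(\<integral>\<^sup>+x. \<integral>\<^sup>+y. ennreal (M powr p) * (indicator ?B y * ?k (x - y)) \<partial>lborel \<partial>lborel)
     = (\<integral>\<^sup>+y. \<integral>\<^sup>+x. ennreal (M powr p) * (indicator ?B y * ?k (x - y)) \<partial>lborel \<partial>lborel)"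
    by (rule lborel_pair.Fubini'[symmetric]) measurable
  also have "\<dots> = ennreal (M powr p) * (?I * emeasure lborel ?B)"
    by (simp add: nn_integral_cmult I2 nn_integral_multc mult.commute)
  also have "(\<integral>\<^sup>+x. \<integral>\<^sup>+y. ennreal (M powr p) * (indicator ?B x * ?k (x - y)) \<partial>lborel \<partial>lborel)
     = ennreal (M powr p) * (?I * emeasure lborel ?B)"
    by (simp add: nn_integral_cmult I1 nn_integral_multc mult.commute)
  also have "ennreal (M powr p) * (?I * emeasure lborel ?B) + ennreal (M powr p) * (?I * emeasure lborel ?B) < \<infinity>"
    using nn_integral_capped_kernel_finite[OF \<sigma>, where 'a='a] emeasure_lborel_ball_finite[of a R]
    by (auto simp: ennreal_mult_less_top)
  finally show ?thesis .
qed

section \<open>Truncated paraboloids\<close>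

definition paraboloid :: "'a::euclidean_space \<Rightarrow> real \<Rightarrow> 'a \<Rightarrow> real" where
  "paraboloid a r x = max 0 (r\<^sup>2 - (norm (x - a))\<^sup>2)"

lemma paraboloid_nonneg: "0 \<le> paraboloid a r x"
  and paraboloid_le: "paraboloid a r x \<le> r\<^sup>2"
  by (auto simp: paraboloid_def)

lemma paraboloid_center: "paraboloid a r a = r\<^sup>2"
  by (simp add: paraboloid_def)

lemma paraboloid_eq_0: "0 \<le> r \<Longrightarrow> x \<notin> ball a r \<Longrightarrow> paraboloid a r x = 0"
  by (auto simp: paraboloid_def dist_norm norm_minus_commute intro!: max_absorb1 power_mono)

lemma continuous_on_paraboloid: "continuous_on A (paraboloid a r)"
  unfolding paraboloid_def by (intro continuous_intros)

lemma borel_measurable_paraboloid [measurable]: "paraboloid a r \<in> borel_measurable borel"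
  by (intro borel_measurable_continuous_onI continuous_on_paraboloid)

lemma paraboloid_lipschitz:
  assumes "0 \<le> r"
  shows "\<bar>paraboloid a r x - paraboloid a r y\<bar> \<le> 2 * r * norm (x - y)"
proof -
  \<comment> \<open>Cutting off the radius instead of the value turns the difference into (n + m)(n
    - m), where n + m <= 2r and the cut-off radii differ by at most |x - y|.\<close>
  have e: "paraboloid a r x = r\<^sup>2 - (min r (norm (x - a)))\<^sup>2" for x
    using assms power_mono[of "norm (x - a)" r 2] power_mono[of r "norm (x - a)" 2]
    by (auto simp: paraboloid_def min_def max_def)
  let ?m = "min r (norm (x - a))" and ?n = "min r (norm (y - a))"
  have "\<bar>?n - ?m\<bar> \<le> \<bar>norm (y - a) - norm (x - a)\<bar>" by (auto simp: min_def)
  also have "\<dots> \<le> norm ((y - a) - (x - a))" by (rule norm_triangle_ineq3)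
  also have "\<dots> = norm (x - y)" by (simp add: norm_minus_commute)
  finally have d: "\<bar>?n - ?m\<bar> \<le> norm (x - y)" .
  have "\<bar>paraboloid a r x - paraboloid a r y\<bar> = \<bar>(?n + ?m) * (?n - ?m)\<bar>"
    by (simp add: e power2_eq_square algebra_simps)
  also have "\<dots> = (?n + ?m) * \<bar>?n - ?m\<bar>" using assms by (simp add: abs_mult)
  also have "\<dots> \<le> (2 * r) * norm (x - y)"
    using assms d by (intro mult_mono) auto
  finally show ?thesis .
qed

text \<open>By the parallelogram law the untruncated paraboloid gives exactly 2|z|^2. Truncation
  only raises the values at x + z and x - z, and it does nothing at x, which lies inside the
  ball.\<close>

lemma paraboloid_second_difference:
  assumes "x \<in> ball a r"
  shows "2 * paraboloid a r x - paraboloid a r (x + z) - paraboloid a r (x - z) \<le> 2 * (norm z)\<^sup>2"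
proof -
  have "(norm (x - a))\<^sup>2 \<le> r\<^sup>2"
    using assms by (intro power_mono) (auto simp: dist_norm norm_minus_commute)
  then have "paraboloid a r x = r\<^sup>2 - (norm (x - a))\<^sup>2" by (simp add: paraboloid_def)
  moreover have "r\<^sup>2 - (norm (x + z - a))\<^sup>2 \<le> paraboloid a r (x + z)"
    "r\<^sup>2 - (norm (x - z - a))\<^sup>2 \<le> paraboloid a r (x - z)"
    by (simp_all add: paraboloid_def)
  moreover have "(norm (x + z - a))\<^sup>2 + (norm (x - z - a))\<^sup>2 = 2 * (norm (x - a))\<^sup>2 + 2 * (norm z)\<^sup>2"
    by (simp add: power2_norm_eq_inner algebra_simps inner_commute)
  ultimately show ?thesis by linarith
qed

lemma gagliardo_pow_paraboloid_finite:
  assumes "0 \<le> r" "0 < \<sigma>" "\<sigma> < 1" "0 < p"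
  shows "gagliardo_pow \<sigma> p (paraboloid a r) < \<infinity>"
proof (rule gagliardo_pow_lipschitz_finite[where M="max (r\<^sup>2) (2 * r)" and a=a and R=r])
  fix x y
  show "\<bar>paraboloid a r x - paraboloid a r y\<bar> \<le> max (r\<^sup>2) (2 * r)"
    using paraboloid_nonneg[of a r x] paraboloid_nonneg[of a r y] paraboloid_le[of a r x] paraboloid_le[of a r y]
    by linarith
  show "\<bar>paraboloid a r x - paraboloid a r y\<bar> \<le> max (r\<^sup>2) (2 * r) * norm (x - y)"
    using paraboloid_lipschitz[OF assms(1), of a x y]
    by (rule order_trans) (auto intro: mult_right_mono)
qed (use assms in \<open>auto intro: paraboloid_eq_0 simp del: mem_ball\<close>)

text \<open>A nonzero value outside the closure would persist on a ball disjoint from \<Omega>,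
  which has positive measure. For empty \<Omega> this says that a continuous function vanishing
  almost everywhere vanishes.\<close>

lemma continuous_AE_zero_imp_zero:
  fixes u :: "'a::euclidean_space \<Rightarrow> real"
  assumes u: "continuous_on UNIV u" and ae: "AE x in lborel. x \<notin> \<Omega> \<longrightarrow> u x = 0" and x: "x \<notin> closure \<Omega>"
  shows "u x = 0"
proof (rule ccontr)
  assume "u x \<noteq> 0"
  let ?U = "- closure \<Omega> \<inter> {y. u y \<noteq> 0}"
  have "open ?U"
    using u by (intro open_Int open_Collect_neq) (auto intro: continuous_intros)
  moreover have "x \<in> ?U" using x \<open>u x \<noteq> 0\<close> by simp
  ultimately obtain e where e: "0 < e" "ball x e \<subseteq> ?U" by (meson open_contains_ball)
  have "AE y in lborel. y \<notin> ball x e"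
    using ae by eventually_elim (use e closure_subset[of \<Omega>] in blast)
  then have "emeasure lborel (ball x e) = 0"
    by (subst (asm) AE_iff_measurable[where N="ball x e"]) auto
  moreover have "emeasure lborel (ball x e) \<noteq> 0"
    using e unit_ball_vol_pos[of "real DIM('a)"] by (simp add: emeasure_ball less_imp_neq[symmetric])
  ultimately show False by simp
qed

lemma frac_sobolev0_cont_eq_0:
  assumes "u \<in> frac_sobolev0_cont \<sigma> p \<Omega>" "x \<notin> closure \<Omega>"
  shows "u x = 0"
  using assms by (intro continuous_AE_zero_imp_zero) (auto simp: frac_sobolev0_cont_def frac_sobolev0_def)

text \<open>Integrability of |u|^p comes from continuity: u vanishes off the closure of \<Omega>,
  which is compact.\<close>

lemma frac_sobolev0_contI:
  fixes u :: "'a::euclidean_space \<Rightarrow> real"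
  assumes u: "continuous_on UNIV u" and ae: "AE x in lborel. x \<notin> \<Omega> \<longrightarrow> u x = 0"
    and fin: "gagliardo_pow \<sigma> p u < \<infinity>" and \<Omega>: "bounded \<Omega>" and p: "0 < p"
  shows "u \<in> frac_sobolev0_cont \<sigma> p \<Omega>"
proof -
  have "integrable lborel (\<lambda>x. indicator (closure \<Omega>) x *\<^sub>R (\<bar>u x\<bar> powr p))"
    using \<Omega> p by (intro borel_integrable_compact continuous_on_powr' continuous_intros)
      (auto intro: continuous_on_subset[OF u])
  also have "(\<lambda>x. indicator (closure \<Omega>) x *\<^sub>R (\<bar>u x\<bar> powr p)) = (\<lambda>x. \<bar>u x\<bar> powr p)"
    using continuous_AE_zero_imp_zero[OF u ae] by (auto simp: fun_eq_iff indicator_def)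
  finally show ?thesis
    using assms borel_measurable_continuous_onI[OF u] by (simp add: frac_sobolev0_cont_def frac_sobolev0_def)
qed

lemma paraboloid_in_frac_sobolev0_cont:
  assumes "ball a r \<subseteq> \<Omega>" "bounded \<Omega>" "0 \<le> r" "0 < \<sigma>" "\<sigma> < 1" "0 < p"
  shows "paraboloid a r \<in> frac_sobolev0_cont \<sigma> p \<Omega>"
  using assms by (intro frac_sobolev0_contI AE_I2 gagliardo_pow_paraboloid_finite continuous_on_paraboloid)
    (auto intro!: paraboloid_eq_0 simp del: mem_ball)

section \<open>Morrey's inequality\<close>

lemma
  fixes g h :: "'a::euclidean_space \<Rightarrow> real"
  assumes g: "integrable lborel g" and h: "integrable lborel h"
  shows integrable_lborel_pair_mult: "integrable (lborel \<Otimes>\<^sub>M lborel) (\<lambda>z. g (fst z) * h (snd z))"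
    and integral_lborel_pair_mult: "(\<integral>z. g (fst z) * h (snd z) \<partial>(lborel \<Otimes>\<^sub>M lborel))
      = (\<integral>x. g x \<partial>lborel) * (\<integral>y. h y \<partial>lborel)"
proof -
  have [measurable]: "g \<in> borel_measurable borel" "h \<in> borel_measurable borel"
    using g h by (auto dest: borel_measurable_integrable)
  show *: "integrable (lborel \<Otimes>\<^sub>M lborel) (\<lambda>z. g (fst z) * h (snd z))"
    using g h by (intro lborel_pair.Fubini_integrable) (auto simp: abs_mult)
  show "(\<integral>z. g (fst z) * h (snd z) \<partial>(lborel \<Otimes>\<^sub>M lborel))
      = (\<integral>x. g x \<partial>lborel) * (\<integral>y. h y \<partial>lborel)"
    using lborel_pair.integral_fst'[OF *] by simp
qed

definition ball_average :: "('a::euclidean_space \<Rightarrow> real) \<Rightarrow> 'a \<Rightarrow> real \<Rightarrow> real" where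
  "ball_average u x \<rho> = (\<integral>y. indicator (ball x \<rho>) y * u y \<partial>lborel) / measure lborel (ball x \<rho>)"

lemma measure_lborel_ball_pos: "0 < \<rho> \<Longrightarrow> 0 < measure lborel (ball (x::'a::euclidean_space) \<rho>)"
  by (simp add: content_ball)

lemma integrable_indicator_ball_lborel:
  "integrable lborel (indicator (ball (x::'a::euclidean_space) \<rho>) :: 'a \<Rightarrow> real)"
  using emeasure_lborel_ball_finite[of x \<rho>] by (intro integrable_real_indicator) (auto simp: less_top)

lemma integrable_indicator_ball_mult:
  fixes u :: "'a::euclidean_space \<Rightarrow> real"
  assumes u: "continuous_on UNIV u"
  shows "integrable lborel (\<lambda>y. indicator (ball x \<rho>) y * u y)"
proof (rule Bochner_Integration.integrable_bound)
  have [measurable]: "u \<in> borel_measurable borel" using u by (rule borel_measurable_continuous_onI)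
  show "integrable lborel (\<lambda>y. indicator (cball x \<rho>) y *\<^sub>R u y)"
    by (intro borel_integrable_compact) (auto intro: continuous_on_subset[OF u])
  show "(\<lambda>y. indicator (ball x \<rho>) y * u y) \<in> borel_measurable lborel" by simp
qed (auto simp: indicator_def)

lemma ball_average_close:
  fixes u :: "'a::euclidean_space \<Rightarrow> real"
  assumes u: "continuous_on UNIV u" and \<rho>: "0 < \<rho>" and close: "\<And>y. y \<in> ball x \<rho> \<Longrightarrow> \<bar>u y - c\<bar> \<le> e"
  shows "\<bar>ball_average u x \<rho> - c\<bar> \<le> e"
proof -
  let ?i = "indicator (ball x \<rho>) :: 'a \<Rightarrow> real"
  have i1: "integrable lborel (\<lambda>y. ?i y * u y)" by (rule integrable_indicator_ball_mult[OF u])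
  have i2: "integrable lborel (\<lambda>y. ?i y * c)" for c
    using integrable_indicator_ball_lborel by (rule integrable_mult_left)
  have m: "(\<integral>y. ?i y * c \<partial>lborel) = measure lborel (ball x \<rho>) * c" for c by simp
  have close': "u y \<le> c + e" "c - e \<le> u y" if "y \<in> ball x \<rho>" for y
    using close[OF that] by linarith+
  have up: "(\<integral>y. ?i y * u y \<partial>lborel) \<le> (\<integral>y. ?i y * (c + e) \<partial>lborel)"
    using close' by (intro integral_mono i1 i2) (simp add: indicator_def)
  have lo: "(\<integral>y. ?i y * (c - e) \<partial>lborel) \<le> (\<integral>y. ?i y * u y \<partial>lborel)"
    using close' by (intro integral_mono i1 i2) (simp add: indicator_def)
  show ?thesis
    using up lo measure_lborel_ball_pos[OF \<rho>, of x] unfolding m ball_average_def abs_le_iff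
    by (auto simp: field_simps)
qed

text \<open>
  Integrated over two balls, this replaces Jensen's inequality for the \<open>p\<close>-th power.
\<close>

lemma le_add_powr:
  fixes l d p :: real
  assumes "0 < l" "0 \<le> d" "1 \<le> p"
  shows "d \<le> l + l powr (1 - p) * d powr p"
proof (cases "d \<le> l")
  case False
  then have d: "0 < d" "l < d" using assms by auto
  have "d = d powr (1 - p) * d powr p" using d by (simp add: powr_add[symmetric])
  also have "\<dots> \<le> l powr (1 - p) * d powr p"
    using d assms by (intro mult_right_mono powr_mono2') auto
  finally show ?thesis using assms by linarith
qed (use assms in \<open>auto intro: add_increasing2\<close>)

text \<open>
  Choosing \<open>l = \<rho>\<^sup>\<gamma>\<close> in the previous lemma makes both terms scale like \<open>\<rho>\<^sup>\<gamma>\<close>, because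
  \<open>\<gamma> p = \<sigma> p - N\<close>.
\<close>

lemma ball_average_diff_le:
  fixes u :: "'a::euclidean_space \<Rightarrow> real"
  assumes u: "continuous_on UNIV u" and fin: "gagliardo_pow \<sigma> p u < \<infinity>"
    and p: "1 \<le> p" "0 < \<sigma>" and \<rho>: "0 < \<rho>" "\<rho> / 2 \<le> \<rho>'" "\<rho>' \<le> \<rho>" and xx: "norm (x - x') \<le> \<rho>"
  shows "\<bar>ball_average u x \<rho> - ball_average u x' \<rho>'\<bar>
    \<le> (1 + 3 powr (real DIM('a) + \<sigma> * p) * 2 ^ DIM('a) / (unit_ball_vol (real DIM('a)))\<^sup>2
          * enn2real (gagliardo_pow \<sigma> p u)) * \<rho> powr (\<sigma> - real DIM('a) / p)"
proof -
  have um [measurable]: "u \<in> borel_measurable borel" using u by (rule borel_measurable_continuous_onI)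
  let ?N = "real DIM('a)"
  let ?E = "?N + \<sigma> * p"
  let ?\<gamma> = "\<sigma> - ?N / p"
  define V where "V = unit_ball_vol ?N"
  let ?G = "enn2real (gagliardo_pow \<sigma> p u)"
  let ?P = "lborel \<Otimes>\<^sub>M lborel :: ('a \<times> 'a) measure"
  define l where "l = \<rho> powr ?\<gamma>"
  have l: "0 < l" using \<rho> by (simp add: l_def)
  \<comment> \<open>Points of the two balls are at distance at most 3\<rho>, so passing from |u y -
    u z|^p to the energy density costs (3\<rho>) to the power \<open>?E\<close>; the other factor
    comes from \<open>le_add_powr\<close>.\<close>
  define c where "c = l powr (1 - p) * (3 * \<rho>) powr ?E"
  have c: "0 \<le> c" by (simp add: c_def)
  let ?A = "indicator (ball x \<rho>) :: 'a \<Rightarrow> real" and ?B = "indicator (ball x' \<rho>') :: 'a \<Rightarrow> real"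
  let ?a = "measure lborel (ball x \<rho>)" and ?b = "measure lborel (ball x' \<rho>')"
  have \<rho>': "0 < \<rho>'" using \<rho> by linarith
  have V: "0 < V" by (simp add: V_def)
  have ab: "0 < ?a" "0 < ?b" using measure_lborel_ball_pos \<rho> \<rho>' by auto
  let ?f1 = "\<lambda>z. (?A (fst z) * u (fst z)) * ?B (snd z)" and ?f2 = "\<lambda>z. ?A (fst z) * (?B (snd z) * u (snd z))"
  let ?g = "\<lambda>z. ?A (fst z) * ?B (snd z)"
  note iA = integrable_indicator_ball_lborel[of x \<rho>] and iB = integrable_indicator_ball_lborel[of x' \<rho>']
  note iu = integrable_indicator_ball_mult[OF u]
  have int: "integrable ?P ?f1" "integrable ?P ?f2" "integrable ?P ?g" "integrable ?P (gagliardo_density \<sigma> p u)"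
    using fin by (auto intro!: integrable_lborel_pair_mult iA iB iu integrable_gagliardo_density)
  have pt: "\<bar>?f1 z - ?f2 z\<bar> \<le> l * ?g z + c * gagliardo_density \<sigma> p u z" for z
  proof (cases "fst z \<in> ball x \<rho> \<and> snd z \<in> ball x' \<rho>'")
    case True
    let ?d = "\<bar>u (fst z) - u (snd z)\<bar>" and ?n = "norm (fst z - snd z)"
    have "fst z - snd z = (fst z - x) + (x - x') + (x' - snd z)" by simp
    then have "?n \<le> norm (fst z - x) + norm (x - x') + norm (x' - snd z)"
      by (metis norm_triangle_ineq norm_triangle_le add_mono order_refl)
    also have "\<dots> \<le> 3 * \<rho>" using True xx \<rho> by (auto simp: dist_norm norm_minus_commute)
    finally have n: "?n \<le> 3 * \<rho>" .
    have "?d powr p \<le> (3 * \<rho>) powr ?E * gagliardo_density \<sigma> p u z"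
    proof (cases "?n = 0")
      case False
      have "?n powr ?E \<le> (3 * \<rho>) powr ?E"
        using n p by (intro powr_mono2) (auto intro: add_nonneg_nonneg)
      then have "?d powr p * (?n powr ?E) \<le> ?d powr p * (3 * \<rho>) powr ?E" by (intro mult_left_mono) auto
      then show ?thesis using False
        by (simp add: gagliardo_density_def field_simps)
    qed (simp add: gagliardo_density_def)
    then have "l powr (1 - p) * ?d powr p \<le> c * gagliardo_density \<sigma> p u z"
      unfolding c_def mult.assoc by (intro mult_left_mono) auto
    with le_add_powr[OF l, of ?d p] p True show ?thesis by simp
  next
    case False
    then show ?thesis using c by (auto simp: gagliardo_density_nonneg)
  qed
  have g: "(\<integral>z. ?g z \<partial>?P) = ?a * ?b"
    unfolding integral_lborel_pair_mult[OF iA iB] by simp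
  have I: "ball_average u x \<rho> * ?a = (\<integral>y. ?A y * u y \<partial>lborel)"
    "ball_average u x' \<rho>' * ?b = (\<integral>y. ?B y * u y \<partial>lborel)"
    using ab by (simp_all add: ball_average_def)
  have f1: "(\<integral>z. ?f1 z \<partial>?P) = ball_average u x \<rho> * ?a * ?b"
    unfolding integral_lborel_pair_mult[OF iu iB] I by simp
  have f2: "(\<integral>z. ?f2 z \<partial>?P) = ?a * (ball_average u x' \<rho>' * ?b)"
    unfolding integral_lborel_pair_mult[OF iA iu] I by simp
  \<comment> \<open>The integral of the increments u y - u z over the product of the two balls;
    divided by both volumes it is the difference of the averages.\<close>
  define F where "F = (\<integral>z. ?f1 z - ?f2 z \<partial>?P)"
  have F: "F = ?a * ?b * (ball_average u x \<rho> - ball_average u x' \<rho>')"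
    unfolding F_def Bochner_Integration.integral_diff[OF int(1,2)] f1 f2 by (simp add: algebra_simps)
  have "\<bar>F\<bar> \<le> (\<integral>z. \<bar>?f1 z - ?f2 z\<bar> \<partial>?P)"
    unfolding F_def by (rule integral_abs_bound)
  also have "\<dots> \<le> (\<integral>z. l * ?g z + c * gagliardo_density \<sigma> p u z \<partial>?P)"
    by (intro integral_mono pt integrable_abs Bochner_Integration.integrable_diff
        Bochner_Integration.integrable_add integrable_mult_right int)
  also have "\<dots> = (\<integral>z. l * ?g z \<partial>?P) + (\<integral>z. c * gagliardo_density \<sigma> p u z \<partial>?P)"
    by (intro Bochner_Integration.integral_add integrable_mult_right int)
  also have "\<dots> = l * (?a * ?b) + c * ?G"
    unfolding integral_mult_right_zero g integral_gagliardo_density[OF um fin] ..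
  finally have "\<bar>F\<bar> \<le> l * (?a * ?b) + c * ?G" .
  then have "\<bar>ball_average u x \<rho> - ball_average u x' \<rho>'\<bar> * (?a * ?b) \<le> l * (?a * ?b) + c * ?G"
    using ab unfolding F by (simp add: abs_mult mult_ac)
  then have "\<bar>ball_average u x \<rho> - ball_average u x' \<rho>'\<bar> \<le> (l * (?a * ?b) + c * ?G) / (?a * ?b)"
    using ab by (subst pos_le_divide_eq) auto
  also have "\<dots> = l + c / (?a * ?b) * ?G"
    using ab by (simp add: add_divide_distrib)
  finally have main: "\<bar>ball_average u x \<rho> - ball_average u x' \<rho>'\<bar> \<le> l + c / (?a * ?b) * ?G" .
  \<comment> \<open>The bound \<rho>' >= \<rho>/2 costs a factor 2^N and lets both volumes be
    expressed through \<rho>.\<close>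
  have "c / (?a * ?b) \<le> c / (V\<^sup>2 * \<rho> powr (2 * ?N) / 2 ^ DIM('a))"
  proof (rule divide_left_mono)
    define m where "m = \<rho> ^ DIM('a)"
    have m: "0 < m" using \<rho> by (simp add: m_def)
    have "(\<rho> / 2) ^ DIM('a) \<le> \<rho>' ^ DIM('a)" using \<rho> by (intro power_mono) auto
    then have le: "m / 2 ^ DIM('a) \<le> \<rho>' ^ DIM('a)" unfolding m_def power_divide .
    have "\<rho> powr (2 * ?N) = m * m"
      using \<rho> unfolding mult_2 powr_add m_def by (simp only: powr_realpow)
    then have "V\<^sup>2 * \<rho> powr (2 * ?N) / 2 ^ DIM('a) = (V * m) * (V * (m / 2 ^ DIM('a)))"
      by (simp add: power2_eq_square)
    also have "\<dots> \<le> (V * m) * (V * \<rho>' ^ DIM('a))"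
      using V m le by (intro mult_left_mono) auto
    also have "\<dots> = ?a * ?b" using \<rho> \<rho>' by (simp add: content_ball m_def V_def)
    finally show "V\<^sup>2 * \<rho> powr (2 * ?N) / 2 ^ DIM('a) \<le> ?a * ?b" .
    show "0 < ?a * ?b * (V\<^sup>2 * \<rho> powr (2 * ?N) / 2 ^ DIM('a))"
      using ab \<rho> V by (intro mult_pos_pos divide_pos_pos) auto
  qed (rule c)
  also have "\<dots> = 3 powr ?E * 2 ^ DIM('a) / V\<^sup>2 * (l powr (1 - p) * \<rho> powr ?E / \<rho> powr (2 * ?N))"
    using \<rho> V by (simp add: c_def powr_mult)
  also have "l powr (1 - p) * \<rho> powr ?E / \<rho> powr (2 * ?N) = l"
  proof -
    have "?\<gamma> * (1 - p) + ?E - 2 * ?N = ?\<gamma>" using p by (simp add: field_simps)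
    then show ?thesis
      using \<rho> by (simp add: l_def powr_powr powr_add[symmetric] powr_diff[symmetric])
  qed
  finally have "c / (?a * ?b) * ?G \<le> 3 powr ?E * 2 ^ DIM('a) / V\<^sup>2 * l * ?G"
    by (intro mult_right_mono) auto
  with main have "\<bar>ball_average u x \<rho> - ball_average u x' \<rho>'\<bar> \<le> l + 3 powr ?E * 2 ^ DIM('a) / V\<^sup>2 * l * ?G"
    by linarith
  then show ?thesis by (simp add: l_def V_def algebra_simps)
qed

text \<open>Under repeated halving of the radius the increments of the averages are dominated by a
  geometric series of ratio q = 2^(-\<gamma>), and the averages converge to u x by continuity. The
  factor 1 / (1 - q) is the sum of that series.\<close>

lemma ball_average_limit_le:
  fixes u :: "'a::euclidean_space \<Rightarrow> real"
  assumes u: "continuous_on UNIV u" and \<gamma>: "0 < \<gamma>" and \<rho>: "0 < \<rho>" and K: "0 \<le> K"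
    and step: "\<And>\<rho>. 0 < \<rho> \<Longrightarrow> \<bar>ball_average u x \<rho> - ball_average u x (\<rho> / 2)\<bar> \<le> K * \<rho> powr \<gamma>"
  shows "\<bar>ball_average u x \<rho> - u x\<bar> \<le> K / (1 - (1 / 2) powr \<gamma>) * \<rho> powr \<gamma>"
proof -
  define q where "q = (1 / 2 :: real) powr \<gamma>"
  have q: "0 < q" "q < 1" using \<gamma> powr_less_mono2[of \<gamma> "1/2" 1] by (auto simp: q_def)
  define C where "C = K / (1 - q) * \<rho> powr \<gamma>"
  \<comment> \<open>The induction needs the exact partial sum, not merely its bound C.\<close>
  have "\<bar>ball_average u x \<rho> - ball_average u x (\<rho> / 2 ^ n)\<bar> \<le> C * (1 - q ^ n)" for n
  proof (induction n)
    case (Suc n)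
    have "\<bar>ball_average u x (\<rho> / 2 ^ n) - ball_average u x (\<rho> / 2 ^ n / 2)\<bar> \<le> K * (\<rho> / 2 ^ n) powr \<gamma>"
      using \<rho> by (intro step) auto
    also have "(\<rho> / 2 ^ n) powr \<gamma> = \<rho> powr \<gamma> * q ^ n"
    proof -
      have "((1 / 2) ^ n) powr \<gamma> = q ^ n"
        unfolding q_def by (simp add: powr_realpow[symmetric] powr_powr mult.commute)
      then show ?thesis using \<rho> powr_mult[of \<rho> "(1 / 2) ^ n" \<gamma>] by (simp add: power_divide)
    qed
    also have "K * (\<rho> powr \<gamma> * q ^ n) = C * (q ^ n - q ^ Suc n)"
      using q by (simp add: C_def field_simps)
    finally show ?case using Suc by (simp add: algebra_simps)
  qed simp
  moreover have "0 \<le> C" using q K by (simp add: C_def)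
  ultimately have le: "\<bar>ball_average u x \<rho> - ball_average u x (\<rho> / 2 ^ n)\<bar> \<le> C" for n
    using q mult_left_mono[of "1 - q ^ n" 1 C] by (meson diff_le_eq dual_order.trans le_add_same_cancel1 mult_left_le zero_le_power less_imp_le)
  have "\<bar>ball_average u x \<rho> - u x\<bar> \<le> C + e" if e: "0 < e" for e
  proof -
    obtain d where d: "0 < d" "\<And>y. dist y x < d \<Longrightarrow> dist (u y) (u x) < e"
      using u e by (meson UNIV_I continuous_on_iff)
    obtain n where "(1 / 2 :: real) ^ n < d / \<rho>"
      using real_arch_pow_inv[of "d / \<rho>" "1 / 2"] d \<rho> by auto
    then have n: "\<rho> / 2 ^ n < d" using \<rho> by (simp add: field_simps power_divide)
    have "\<bar>ball_average u x (\<rho> / 2 ^ n) - u x\<bar> \<le> e"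
    proof (rule ball_average_close[OF u])
      fix y assume "y \<in> ball x (\<rho> / 2 ^ n)"
      then show "\<bar>u y - u x\<bar> \<le> e" using d(2)[of y] n by (simp add: dist_commute dist_real_def)
    qed (use \<rho> in simp)
    then show ?thesis using le[of n] by linarith
  qed
  then show ?thesis unfolding C_def q_def by (rule field_le_epsilon)
qed

text \<open>Averages over balls of radius |x - y| link u x to u y. In D, the 1 stands for the
  passage between the two averages, and each of the two terms 1 / (1 - 2^(-\<gamma>)) for the
  passage from an average to a point value. The dependence on the energy is not homogeneous, but the
  bound is uniform on sets of bounded energy.\<close>

theorem morrey:
  fixes \<sigma> p :: real
  assumes \<sigma>: "0 < \<sigma>" and p: "real DIM('a) / \<sigma> < p" "1 \<le> p"
  obtains C where "0 < C"
    "\<And>u x y. continuous_on UNIV u \<Longrightarrow> gagliardo_pow \<sigma> p u < \<infinity> \<Longrightarrow>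
      \<bar>u x - u y\<bar> \<le> C * (1 + enn2real (gagliardo_pow \<sigma> p u))
        * norm (x - (y :: 'a::euclidean_space)) powr (\<sigma> - real DIM('a) / p)"
proof -
  let ?\<gamma> = "\<sigma> - real DIM('a) / p"
  define C where "C = 3 powr (real DIM('a) + \<sigma> * p) * 2 ^ DIM('a) / (unit_ball_vol (real DIM('a)))\<^sup>2"
  have C: "0 \<le> C" by (simp add: C_def)
  define D where "D = 1 + 2 / (1 - (1 / 2) powr ?\<gamma>)"
  have \<gamma>: "0 < ?\<gamma>" using \<sigma> p by (simp add: field_simps)
  have "(1 / 2) powr ?\<gamma> < 1" using \<gamma> powr_less_mono2[of ?\<gamma> "1/2" 1] by auto
  then have D: "0 < D" by (auto simp: D_def intro!: add_pos_pos)
  have *: "\<bar>u x - u y\<bar> \<le> ((1 + C) * D) * (1 + enn2real (gagliardo_pow \<sigma> p u)) * norm (x - y) powr ?\<gamma>"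
    if u: "continuous_on UNIV u" "gagliardo_pow \<sigma> p u < \<infinity>" for u and x y :: 'a
  proof (cases "x = y")
    case False
    define \<rho> where "\<rho> = norm (x - y)"
    have \<rho>: "0 < \<rho>" using False by (simp add: \<rho>_def)
    let ?G = "enn2real (gagliardo_pow \<sigma> p u)"
    define K where "K = 1 + C * ?G"
    have K: "0 \<le> K" using C by (simp add: K_def)
    note diff = ball_average_diff_le[OF u p(2) \<sigma>, folded C_def, folded K_def]
    have lim: "\<bar>ball_average u x \<rho> - u x\<bar> \<le> K / (1 - (1 / 2) powr ?\<gamma>) * \<rho> powr ?\<gamma>" for x
      using u \<gamma> \<rho> K by (intro ball_average_limit_le diff) auto
    have "\<bar>ball_average u x \<rho> - ball_average u y \<rho>\<bar> \<le> K * \<rho> powr ?\<gamma>"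
      using \<rho> by (intro diff) (auto simp: \<rho>_def)
    then have "\<bar>u x - u y\<bar> \<le> K * \<rho> powr ?\<gamma> + 2 * (K / (1 - (1 / 2) powr ?\<gamma>) * \<rho> powr ?\<gamma>)"
      using lim[of x] lim[of y] by linarith
    also have "\<dots> = K * (D * \<rho> powr ?\<gamma>)" by (simp add: D_def algebra_simps)
    also have "\<dots> \<le> ((1 + C) * (1 + ?G)) * (D * \<rho> powr ?\<gamma>)"
      using D C by (intro mult_right_mono) (auto simp: K_def algebra_simps)
    finally show ?thesis by (simp add: \<rho>_def mult_ac)
  qed simp
  have "0 < (1 + C) * D" using C D by simp
  then show ?thesis using * by (rule that)
qed

section \<open>Existence of a minimizer\<close>

text \<open>Fatou's lemma for the densities. The energies are compared with a convergent sequence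
  because, for the second component of a minimizing sequence, only an upper bound with a known limit
  will be at hand.\<close>

lemma gagliardo_pow_lsc:
  fixes U :: "nat \<Rightarrow> 'a::euclidean_space \<Rightarrow> real"
  assumes [measurable]: "\<And>n. U n \<in> borel_measurable borel" "u \<in> borel_measurable borel"
    and lim: "\<And>x. (\<lambda>n. U n x) \<longlonglongrightarrow> u x" and p: "0 < p"
    and bd: "\<And>n. gagliardo_pow \<sigma> p (U n) \<le> ennreal (e n)" and e: "e \<longlonglongrightarrow> l"
  shows "gagliardo_pow \<sigma> p u \<le> ennreal l"
proof -
  have dens: "(\<lambda>n. gagliardo_density \<sigma> p (U n) z) \<longlonglongrightarrow> gagliardo_density \<sigma> p u z" for z
    unfolding gagliardo_density_def divide_inverse
    by (intro tendsto_mult_right tendsto_powr2 tendsto_rabs tendsto_diff lim tendsto_const always_eventually allI p) simp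
  have "gagliardo_pow \<sigma> p u = (\<integral>\<^sup>+z. liminf (\<lambda>n. ennreal (gagliardo_density \<sigma> p (U n) z)) \<partial>(lborel \<Otimes>\<^sub>M lborel))"
    by (subst gagliardo_pow_eq_nn_integral)
      (auto intro!: nn_integral_cong lim_imp_Liminf[symmetric] tendsto_ennrealI dens)
  also have "\<dots> \<le> liminf (\<lambda>n. \<integral>\<^sup>+z. ennreal (gagliardo_density \<sigma> p (U n) z) \<partial>(lborel \<Otimes>\<^sub>M lborel))"
    by (intro nn_integral_liminf) measurable
  also have "\<dots> = liminf (\<lambda>n. gagliardo_pow \<sigma> p (U n))"
    by (simp add: gagliardo_pow_eq_nn_integral)
  also have "\<dots> \<le> liminf (\<lambda>n. ennreal (e n))"
    by (intro Liminf_mono always_eventually allI bd)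
  also have "\<dots> = ennreal l"
    using e by (intro lim_imp_Liminf tendsto_ennrealI) auto
  finally show ?thesis .
qed

lemma frac_sobolev0_contD:
  fixes u :: "'a::euclidean_space \<Rightarrow> real" and \<Omega> :: "'a set"
  assumes "u \<in> frac_sobolev0_cont \<sigma> p \<Omega>"
  shows "continuous_on UNIV u" "u \<in> borel_measurable borel" "gagliardo_pow \<sigma> p u < \<infinity>"
    "AE x in lborel. x \<notin> \<Omega> \<longrightarrow> u x = 0"
  using assms by (auto simp: frac_sobolev0_cont_def frac_sobolev0_def)

lemma holder_imp_continuous:
  fixes u :: "'a::euclidean_space \<Rightarrow> real"
  assumes "0 < \<gamma>" and h: "\<And>x y. \<bar>u x - u y\<bar> \<le> D * norm (x - y) powr \<gamma>"
  shows "continuous_on UNIV u"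
proof (unfold continuous_on_def, intro ballI)
  fix x :: 'a
  have "((\<lambda>y. D * norm (y - x) powr \<gamma>) \<longlongrightarrow> D * 0 powr \<gamma>) (at x)"
    using assms(1) by (intro tendsto_mult_left tendsto_powr2 tendsto_const tendsto_norm_zero LIM_zero tendsto_ident_at) auto
  then have "((\<lambda>y. D * norm (y - x) powr \<gamma>) \<longlongrightarrow> 0) (at x)" by simp
  then have "((\<lambda>y. u y - u x) \<longlongrightarrow> 0) (at x)"
    by (rule Lim_null_comparison[rotated]) (use h in \<open>auto simp: always_eventually\<close>)
  then show "(u \<longlongrightarrow> u x) (at x within UNIV)" by (rule LIM_zero_cancel)
qed

text \<open>A common energy bound gives a common Hoelder estimate. Arzela-Ascoli is applied on a
  ball containing the closure of \<Omega>, outside which all members vanish. The limit is continuous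
  also across the boundary of that ball, because the Hoelder estimate passes to pointwise
  limits.\<close>

lemma frac_sobolev0_cont_seq_compact:
  fixes U :: "nat \<Rightarrow> 'a::euclidean_space \<Rightarrow> real"
  assumes U: "\<And>n. U n \<in> frac_sobolev0_cont \<sigma> p \<Omega>" and M: "\<And>n. enn2real (gagliardo_pow \<sigma> p (U n)) \<le> M"
    and \<Omega>: "bounded \<Omega>" and \<sigma>: "0 < \<sigma>" and p: "real DIM('a) / \<sigma> < p" "1 \<le> p"
  obtains u k where "strict_mono (k :: nat \<Rightarrow> nat)" "continuous_on UNIV u"
    "\<And>x. (\<lambda>n. U (k n) x) \<longlonglongrightarrow> u x" "AE x in lborel. x \<notin> \<Omega> \<longrightarrow> u x = 0"
proof -
  let ?\<gamma> = "\<sigma> - real DIM('a) / p"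
  have \<gamma>: "0 < ?\<gamma>" using \<sigma> p by (simp add: field_simps)
  obtain C where C: "0 < C" and mor:
    "\<And>u x y. continuous_on UNIV u \<Longrightarrow> gagliardo_pow \<sigma> p u < \<infinity> \<Longrightarrow>
      \<bar>u x - u y\<bar> \<le> C * (1 + enn2real (gagliardo_pow \<sigma> p u)) * norm (x - (y :: 'a)) powr ?\<gamma>"
    using morrey[OF \<sigma> p] by blast
  define D where "D = C * (1 + M)"
  have "0 \<le> M" using M[of 0] enn2real_nonneg order_trans by blast
  then have D: "0 < D" using C by (simp add: D_def)
  have hol: "\<bar>U n x - U n y\<bar> \<le> D * norm (x - y) powr ?\<gamma>" for n x y
  proof -
    have "\<bar>U n x - U n y\<bar> \<le> C * (1 + enn2real (gagliardo_pow \<sigma> p (U n))) * norm (x - y) powr ?\<gamma>"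
      using U[of n] by (intro mor frac_sobolev0_contD) auto
    also have "\<dots> \<le> D * norm (x - y) powr ?\<gamma>"
      using M[of n] C unfolding D_def by (intro mult_right_mono mult_left_mono) auto
    finally show ?thesis .
  qed
  obtain R where R: "0 < R" "closure \<Omega> \<subseteq> cball 0 R"
    using \<Omega> bounded_closure[OF \<Omega>] bounded_pos[of "closure \<Omega>"] by (auto simp: subset_iff)
  obtain b :: 'a where b: "b \<in> Basis" using nonempty_Basis by blast
  \<comment> \<open>A point where every \<open>U n\<close> vanishes, within 3R of every point of the
    ball: the Hoelder estimate from there is the uniform bound that Arzela-Ascoli asks for.\<close>
  define o' where "o' = (2 * R) *\<^sub>R b"
  have o': "o' \<notin> cball 0 R" using R b by (simp add: o'_def)
  have out: "U n x = 0" if "x \<notin> cball 0 R" for n x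
    using frac_sobolev0_cont_eq_0[OF U[of n], of x] R that by blast
  obtain g k where k: "strict_mono (k :: nat \<Rightarrow> nat)"
    and conv: "\<And>e. 0 < e \<Longrightarrow> \<exists>N. \<forall>n x. n \<ge> N \<and> x \<in> cball 0 R \<longrightarrow> norm (U (k n) x - g x) < e"
  proof (rule Arzela_Ascoli[of "cball (0::'a) R" U "D * (3 * R) powr ?\<gamma>"])
    fix n x assume x: "x \<in> cball (0::'a) R"
    have "norm (x - o') \<le> norm x + norm o'" by (rule norm_triangle_ineq4)
    also have "\<dots> \<le> 3 * R" using x R b by (simp add: o'_def)
    finally have "D * norm (x - o') powr ?\<gamma> \<le> D * (3 * R) powr ?\<gamma>"
      using D \<gamma> by (intro mult_left_mono powr_mono2) auto
    then show "norm (U n x) \<le> D * (3 * R) powr ?\<gamma>"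
      using hol[of n x o'] out[OF o'] by simp
  next
    fix x and e :: real assume e: "0 < e"
    \<comment> \<open>Solves D d^\<gamma> = e, with \<gamma> the Hoelder exponent.\<close>
    define d where "d = (e / D) powr (1 / ?\<gamma>)"
    have "norm (U n x - U n y) < e" if "norm (x - y) < d" for n y
    proof -
      have "norm (x - y) powr ?\<gamma> < d powr ?\<gamma>"
        using that \<gamma> by (intro powr_less_mono2) auto
      also have "\<dots> = e / D" using e D \<gamma> by (simp add: d_def powr_powr)
      finally have "D * norm (x - y) powr ?\<gamma> < e" using D by (simp add: field_simps)
      with hol[of n x y] show ?thesis by simp
    qed
    moreover have "0 < d" using e D by (simp add: d_def)
    ultimately show "\<exists>d>0. \<forall>n y. y \<in> cball 0 R \<and> norm (x - y) < d \<longrightarrow> norm (U n x - U n y) < e"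
      by blast
  qed auto
  define u where "u x = (if x \<in> cball 0 R then g x else 0)" for x
  have lim: "(\<lambda>n. U (k n) x) \<longlonglongrightarrow> u x" for x
  proof (cases "x \<in> cball 0 R")
    case True
    show ?thesis
    proof (rule LIMSEQ_I)
      fix e :: real assume "0 < e"
      from conv[OF this] True show "\<exists>N. \<forall>n\<ge>N. norm (U (k n) x - u x) < e"
        by (auto simp: u_def)
    qed
  next
    case False
    then show ?thesis using out[OF False] by (simp add: u_def)
  qed
  have "\<bar>u x - u y\<bar> \<le> D * norm (x - y) powr ?\<gamma>" for x y
    by (rule LIMSEQ_le_const2[OF tendsto_rabs[OF tendsto_diff[OF lim[of x] lim[of y]]]])
      (use hol in auto)
  then have cont: "continuous_on UNIV u" by (rule holder_imp_continuous[OF \<gamma>])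
  have "AE x in lborel. \<forall>n. x \<notin> \<Omega> \<longrightarrow> U (k n) x = 0"
    by (subst AE_all_countable) (use frac_sobolev0_contD(4)[OF U] in blast)
  then have "AE x in lborel. x \<notin> \<Omega> \<longrightarrow> u x = 0"
  proof eventually_elim
    case (elim x)
    then show ?case using LIMSEQ_unique[OF lim[of x]] by auto
  qed
  with k cont lim show ?thesis by (rule that)
qed

lemma frac_sobolev0_cont_cmult:
  assumes u: "u \<in> frac_sobolev0_cont \<sigma> p \<Omega>" and \<Omega>: "bounded \<Omega>" "0 < p"
  shows "(\<lambda>x. c * u x) \<in> frac_sobolev0_cont \<sigma> p \<Omega>"
proof (rule frac_sobolev0_contI[OF _ _ _ \<Omega>])
  note u' = frac_sobolev0_contD[OF u]
  show "continuous_on UNIV (\<lambda>x. c * u x)" by (intro continuous_intros u')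
  show "AE x in lborel. x \<notin> \<Omega> \<longrightarrow> c * u x = 0" using u'(4) by eventually_elim auto
  show "gagliardo_pow \<sigma> p (\<lambda>x. c * u x) < \<infinity>"
    using u' by (simp add: gagliardo_pow_cmult ennreal_mult_less_top)
qed

lemma frac_sobolev0_cont_abs:
  assumes u: "u \<in> frac_sobolev0_cont \<sigma> p \<Omega>" and \<Omega>: "bounded \<Omega>" "0 < p"
  shows "(\<lambda>x. \<bar>u x\<bar>) \<in> frac_sobolev0_cont \<sigma> p \<Omega>"
proof (rule frac_sobolev0_contI[OF _ _ _ \<Omega>])
  note u' = frac_sobolev0_contD[OF u]
  show "continuous_on UNIV (\<lambda>x. \<bar>u x\<bar>)" by (intro continuous_intros u')
  show "AE x in lborel. x \<notin> \<Omega> \<longrightarrow> \<bar>u x\<bar> = 0" using u'(4) by eventually_elim auto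
  have "gagliardo_pow \<sigma> p (\<lambda>x. \<bar>u x\<bar>) \<le> gagliardo_pow \<sigma> p u"
    using \<Omega> by (intro gagliardo_pow_mono) auto
  with u' show "gagliardo_pow \<sigma> p (\<lambda>x. \<bar>u x\<bar>) < \<infinity>" by (simp add: order_le_less_trans)
qed

text \<open>Zero energy is inherited by every multiple c u. The inhomogeneous Morrey bound for c u,
  between x and a zero y of u, therefore bounds c |u x| independently of c.\<close>

lemma frac_sobolev0_cont_pos:
  assumes u: "u \<in> frac_sobolev0_cont \<sigma> p \<Omega>" and \<Omega>: "bounded \<Omega>"
    and \<sigma>: "0 < \<sigma>" and p: "real DIM('a) / \<sigma> < p" "1 \<le> p"
    and x: "u (x :: 'a::euclidean_space) \<noteq> 0"
  shows "0 < enn2real (gagliardo_pow \<sigma> p u)"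
proof (rule ccontr)
  let ?\<gamma> = "\<sigma> - real DIM('a) / p"
  note u' = frac_sobolev0_contD[OF u]
  assume "\<not> 0 < enn2real (gagliardo_pow \<sigma> p u)"
  then have 0: "gagliardo_pow \<sigma> p u = 0" using u'(3) by (auto simp: enn2real_positive_iff)
  obtain C where C: "0 < C" and mor:
    "\<And>u x y. continuous_on UNIV u \<Longrightarrow> gagliardo_pow \<sigma> p u < \<infinity> \<Longrightarrow>
      \<bar>u x - u y\<bar> \<le> C * (1 + enn2real (gagliardo_pow \<sigma> p u)) * norm (x - (y :: 'a)) powr ?\<gamma>"
    using morrey[OF \<sigma> p] by blast
  have "\<not> closure \<Omega> = UNIV" using bounded_closure[OF \<Omega>] not_bounded_UNIV by metis
  then obtain y where "y \<notin> closure \<Omega>" by blast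
  then have y: "u y = 0" using frac_sobolev0_cont_eq_0[OF u] by blast
  have "c * \<bar>u x\<bar> \<le> C * norm (x - y) powr ?\<gamma>" if "0 < c" for c
    using mor[of "\<lambda>x. c * u x" x y] u' y that
    by (simp add: gagliardo_pow_cmult 0 abs_mult continuous_intros)
  \<comment> \<open>With this c the left-hand side exceeds the right-hand side by 1.\<close>
  from this[of "(C * norm (x - y) powr ?\<gamma> + 1) / \<bar>u x\<bar>"] show False
    using x C by (simp add: add_nonneg_pos)
qed

section \<open>The quotient, its scaling and its infimum\<close>

lemma X_star_normalize:
  assumes uv: "(u, v) \<in> X_star s t p \<Omega> x1 x2" and \<Omega>: "bounded \<Omega>" "0 < p" and ab: "\<alpha> p + \<beta> p = p"
  obtains u' v' where "(u', v') \<in> X_star s t p \<Omega> x1 x2" "\<bar>u' x1\<bar> powr \<alpha> p * \<bar>v' x2\<bar> powr \<beta> p = 1"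
    "Q_quot s t \<alpha> \<beta> x1 x2 p u' v' = Q_quot s t \<alpha> \<beta> x1 x2 p u v"
proof -
  define D where "D = \<bar>u x1\<bar> powr \<alpha> p * \<bar>v x2\<bar> powr \<beta> p"
  have u: "u \<in> frac_sobolev0_cont s p \<Omega>" and v: "v \<in> frac_sobolev0_cont t p \<Omega>" and nz: "u x1 \<noteq> 0" "v x2 \<noteq> 0"
    using uv by (auto simp: X_star_def X_space_def)
  have D: "0 < D" using nz by (simp add: D_def)
  \<comment> \<open>Energies scale by c^p and the denominator by c^(\<alpha> + \<beta>) = c^p, so
    this c turns the denominator D into 1 and leaves the quotient unchanged.\<close>
  define c where "c = D powr (- 1 / p)"
  have c: "0 < c" using D by (simp add: c_def)
  have cp: "c powr p = 1 / D" 
  proof -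
    have "c powr p = D powr (- 1 / p * p)" unfolding c_def by (rule powr_powr)
    also have "\<dots> = 1 / D" using D \<Omega> by (simp add: powr_minus_divide)
    finally show ?thesis .
  qed
  have den: "\<bar>c * u x1\<bar> powr \<alpha> p * \<bar>c * v x2\<bar> powr \<beta> p = 1"
  proof -
    have "\<bar>c * u x1\<bar> powr \<alpha> p * \<bar>c * v x2\<bar> powr \<beta> p = (c powr \<alpha> p * c powr \<beta> p) * D"
      using c by (simp add: abs_mult powr_mult D_def mult_ac)
    also have "c powr \<alpha> p * c powr \<beta> p = 1 / D" using cp by (simp add: powr_add[symmetric] ab)
    finally show ?thesis using D by simp
  qed
  show ?thesis
  proof
    show "(\<lambda>x. c * u x, \<lambda>x. c * v x) \<in> X_star s t p \<Omega> x1 x2"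
      using u v nz c \<Omega> by (auto simp: X_star_def X_space_def intro: frac_sobolev0_cont_cmult)
    show "\<bar>c * u x1\<bar> powr \<alpha> p * \<bar>c * v x2\<bar> powr \<beta> p = 1" by (rule den)
    show "Q_quot s t \<alpha> \<beta> x1 x2 p (\<lambda>x. c * u x) (\<lambda>x. c * v x) = Q_quot s t \<alpha> \<beta> x1 x2 p u v"
      unfolding Q_quot_def den D_def[symmetric] using c D cp frac_sobolev0_contD(2)[OF u] frac_sobolev0_contD(2)[OF v]
      by (simp add: gagliardo_pow_cmult enn2real_mult add_divide_distrib[symmetric] distrib_left[symmetric])
  qed
qed

lemma bdd_below_Q_quot:
  "0 < p \<Longrightarrow> bdd_below ((\<lambda>(u, v). Q_quot s t \<alpha> \<beta> x1 x2 p u v) ` A)"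
  by (rule bdd_belowI[of _ 0]) (auto simp: Q_quot_def)

lemma Lambda1_le:
  assumes "(u, v) \<in> X_star s t p \<Omega> x1 x2" "0 < p"
  shows "Lambda1 s t \<Omega> \<alpha> \<beta> x1 x2 p \<le> Q_quot s t \<alpha> \<beta> x1 x2 p u v"
  unfolding Lambda1_def using cINF_lower[OF bdd_below_Q_quot[OF assms(2)] assms(1)] by auto

lemma X_star_nonempty:
  assumes "open \<Omega>" "bounded \<Omega>" "x1 \<in> \<Omega>" "x2 \<in> \<Omega>" "0 < s" "s < 1" "0 < t" "t < 1" "0 < p"
  shows "X_star s t p \<Omega> x1 x2 \<noteq> {}"
proof -
  obtain r1 r2 where r: "0 < r1" "ball x1 r1 \<subseteq> \<Omega>" "0 < r2" "ball x2 r2 \<subseteq> \<Omega>"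
    using assms by (meson open_contains_ball)
  then have "(paraboloid x1 r1, paraboloid x2 r2) \<in> X_star s t p \<Omega> x1 x2"
    using assms by (auto simp: X_star_def X_space_def paraboloid_center intro!: paraboloid_in_frac_sobolev0_cont)
  then show ?thesis by blast
qed

text \<open>Lower semicontinuity is available for each energy, while only the sum is known to
  approach p L. Along a further subsequence the first energy converges to some a; the second is then
  bounded by a sequence tending to p L - a, and the two limit bounds add up to p L.\<close>

lemma Lambda1_minimizer:
  fixes \<Omega> :: "'a::euclidean_space set"
  assumes \<Omega>: "open \<Omega>" "bounded \<Omega>" "x1 \<in> \<Omega>" "x2 \<in> \<Omega>"
    and st: "0 < s" "s < 1" "0 < t" "t < 1"
    and p: "real DIM('a) / s < p" "real DIM('a) / t < p" "1 < p"
    and ab: "0 < \<alpha> p" "0 < \<beta> p" "\<alpha> p + \<beta> p = p"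
  obtains u v where "(u, v) \<in> X_star s t p \<Omega> x1 x2" "\<And>x. 0 \<le> u x" "\<And>x. 0 \<le> v x"
    "\<bar>u x1\<bar> powr \<alpha> p * \<bar>v x2\<bar> powr \<beta> p = 1"
    "Lambda1 s t \<Omega> \<alpha> \<beta> x1 x2 p = Q_quot s t \<alpha> \<beta> x1 x2 p u v"
proof -
  have p0: "0 < p" using p by simp
  let ?X = "X_star s t p \<Omega> x1 x2" and ?Q = "Q_quot s t \<alpha> \<beta> x1 x2 p"
  let ?D = "\<lambda>u v. \<bar>u x1\<bar> powr \<alpha> p * \<bar>v x2\<bar> powr \<beta> p"
  define L where "L = Lambda1 s t \<Omega> \<alpha> \<beta> x1 x2 p"
  let ?Es = "\<lambda>u. enn2real (gagliardo_pow s p u)" and ?Et = "\<lambda>u. enn2real (gagliardo_pow t p u)"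
  have ne: "?X \<noteq> {}" using \<Omega> st p0 by (intro X_star_nonempty)
  have "\<exists>w. w \<in> ?X \<and> ?D (fst w) (snd w) = 1 \<and> ?Q (fst w) (snd w) < L + 1 / real (Suc n)" for n
  proof -
    have "\<exists>w\<in>?X. (case w of (u, v) \<Rightarrow> ?Q u v) < L + 1 / real (Suc n)"
      by (subst cINF_less_iff[symmetric, OF ne bdd_below_Q_quot[OF p0]]) (simp add: L_def Lambda1_def)
    then obtain u v where "(u, v) \<in> ?X" "?Q u v < L + 1 / real (Suc n)" by auto
    then show ?thesis
      using X_star_normalize[of u v s t p \<Omega> x1 x2 \<alpha> \<beta>] \<Omega>(2) p0 ab(3) by (metis fst_conv snd_conv)
  qed
  then obtain W where W: "\<And>n. W n \<in> ?X" "\<And>n. ?D (fst (W n)) (snd (W n)) = 1"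
    "\<And>n. ?Q (fst (W n)) (snd (W n)) < L + 1 / real (Suc n)" by metis
  define U where "U n = fst (W n)" for n
  define V where "V n = snd (W n)" for n
  have U: "U n \<in> frac_sobolev0_cont s p \<Omega>" and V: "V n \<in> frac_sobolev0_cont t p \<Omega>" for n
    using W(1)[of n] by (auto simp: X_star_def X_space_def U_def V_def)
  have D1: "?D (U n) (V n) = 1" for n using W(2) by (simp add: U_def V_def)
  have sum: "?Es (U n) + ?Et (V n) \<le> p * L + p * inverse (real (Suc n))" for n
  proof -
    have "1 / p * ?Es (U n) + 1 / p * ?Et (V n) < L + 1 / real (Suc n)"
      using W(3)[of n] W(2)[of n] by (simp add: Q_quot_def U_def V_def)
    then have "p * (1 / p * ?Es (U n) + 1 / p * ?Et (V n)) \<le> p * (L + 1 / real (Suc n))"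
      using p0 by (intro mult_left_mono) auto
    then show ?thesis using p0 by (simp add: distrib_left inverse_eq_divide)
  qed
  define M where "M = p * L + p"
  have M: "?Es (U n) \<le> M" "?Et (V n) \<le> M" for n
  proof -
    have "p * inverse (real (Suc n)) \<le> p" using p0 by (simp add: field_simps)
    then have "?Es (U n) + ?Et (V n) \<le> M" using sum[of n] by (simp add: M_def)
    then show "?Es (U n) \<le> M" "?Et (V n) \<le> M"
      using enn2real_nonneg[of "gagliardo_pow s p (U n)"] enn2real_nonneg[of "gagliardo_pow t p (V n)"] by linarith+
  qed
  obtain u k1 where k1: "strict_mono (k1 :: nat \<Rightarrow> nat)" and u: "continuous_on UNIV u"
    "\<And>x. (\<lambda>n. U (k1 n) x) \<longlonglongrightarrow> u x" "AE x in lborel. x \<notin> \<Omega> \<longrightarrow> u x = 0"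
    by (rule frac_sobolev0_cont_seq_compact[of U, OF U M(1) \<Omega>(2) st(1) p(1) less_imp_le[OF p(3)]]) (rule that)
  obtain v k2 where k2: "strict_mono (k2 :: nat \<Rightarrow> nat)" and v: "continuous_on UNIV v"
    "\<And>x. (\<lambda>n. V (k1 (k2 n)) x) \<longlonglongrightarrow> v x" "AE x in lborel. x \<notin> \<Omega> \<longrightarrow> v x = 0"
    by (rule frac_sobolev0_cont_seq_compact[where U = "\<lambda>n. V (k1 n)", OF V M(2) \<Omega>(2) st(3) p(2) less_imp_le[OF p(3)]]) (rule that)
  have "\<exists>a\<in>{0..M}. \<exists>r. strict_mono r \<and> ((\<lambda>n. ?Es (U (k1 (k2 n)))) \<circ> r) \<longlonglongrightarrow> a"
    by (rule compact_Icc[of 0 M, unfolded compact_def, rule_format]) (use M in simp)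
  then obtain a k3 where k3: "strict_mono (k3 :: nat \<Rightarrow> nat)"
    and a: "((\<lambda>n. ?Es (U (k1 (k2 n)))) \<circ> k3) \<longlonglongrightarrow> a" by auto
  define k where "k n = k1 (k2 (k3 n))" for n
  have k: "strict_mono k" using k1 k2 k3 by (simp add: k_def strict_mono_def)
  have a': "(\<lambda>n. ?Es (U (k n))) \<longlonglongrightarrow> a" using a by (simp add: k_def o_def)
  have uk: "(\<lambda>n. U (k n) x) \<longlonglongrightarrow> u x" and vk: "(\<lambda>n. V (k n) x) \<longlonglongrightarrow> v x" for x
    using LIMSEQ_subseq_LIMSEQ[OF u(2)[of x], of "k2 \<circ> k3"] LIMSEQ_subseq_LIMSEQ[OF v(2)[of x] k3] k2 k3
    by (simp_all add: k_def o_def strict_mono_def)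
  have um: "u \<in> borel_measurable borel" "v \<in> borel_measurable borel"
    using u v by (auto intro: borel_measurable_continuous_onI)
  note U' = frac_sobolev0_contD[OF U] and V' = frac_sobolev0_contD[OF V]
  have Gu: "gagliardo_pow s p u \<le> ennreal a"
  proof (rule gagliardo_pow_lsc[where U="\<lambda>n. U (k n)", OF _ _ _ _ _ a'])
    show "gagliardo_pow s p (U (k n)) \<le> ennreal (?Es (U (k n)))" for n using U'(3) by simp
  qed (use U'(2) um uk p0 in blast)+
  \<comment> \<open>What the bound on the sum leaves for the energy of
    \<open>V (k n)\<close>.\<close>
  define e where "e n = p * L + p * inverse (real (Suc (k n))) - ?Es (U (k n))" for n
  have "(\<lambda>n. inverse (real (Suc (k n)))) \<longlonglongrightarrow> 0"
    using LIMSEQ_subseq_LIMSEQ[OF LIMSEQ_inverse_real_of_nat k] by (simp add: o_def)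
  from tendsto_diff[OF tendsto_add[OF tendsto_const[of "p * L"] tendsto_mult_left[OF this, of p]] a']
  have e: "e \<longlonglongrightarrow> p * L - a" by (simp add: e_def[abs_def])
  have Ve: "?Et (V (k n)) \<le> e n" for n using sum[of "k n"] by (simp add: e_def)
  have Gv: "gagliardo_pow t p v \<le> ennreal (p * L - a)"
  proof (rule gagliardo_pow_lsc[where U="\<lambda>n. V (k n)", OF _ _ _ _ _ e])
    fix n
    have "gagliardo_pow t p (V (k n)) = ennreal (?Et (V (k n)))" using V'(3) by simp
    also have "\<dots> \<le> ennreal (e n)" by (intro ennreal_leI Ve)
    finally show "gagliardo_pow t p (V (k n)) \<le> ennreal (e n)" .
  qed (use V'(2) um vk p0 in blast)+
  have a0: "0 \<le> a" by (rule LIMSEQ_le_const[OF a']) auto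
  have b0: "0 \<le> p * L - a"
    by (rule LIMSEQ_le_const[OF e]) (use Ve order_trans[OF enn2real_nonneg] in blast)
  \<comment> \<open>Convergence at the two points x1 and x2 carries the constraint to the limit;
    positive exponents keep the powers continuous even at 0. A limiting denominator 1 then excludes
    zeros there.\<close>
  have Dlim: "(\<lambda>n. ?D (U (k n)) (V (k n))) \<longlonglongrightarrow> ?D u v"
    using ab by (intro tendsto_mult tendsto_powr2 tendsto_rabs uk vk tendsto_const always_eventually) auto
  then have "(\<lambda>n. 1) \<longlonglongrightarrow> ?D u v" unfolding D1 .
  then have Duv: "?D u v = 1" by (simp only: LIMSEQ_const_iff)
  then have nz: "u x1 \<noteq> 0" "v x2 \<noteq> 0" by auto
  have fin: "gagliardo_pow s p u < \<infinity>" "gagliardo_pow t p v < \<infinity>"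
    using Gu Gv by (auto intro: order_le_less_trans)
  have uS: "u \<in> frac_sobolev0_cont s p \<Omega>"
    by (rule frac_sobolev0_contI[OF u(1) u(3) fin(1) \<Omega>(2) p0])
  have vS: "v \<in> frac_sobolev0_cont t p \<Omega>"
    by (rule frac_sobolev0_contI[OF v(1) v(3) fin(2) \<Omega>(2) p0])
  let ?u = "\<lambda>x. \<bar>u x\<bar>" and ?v = "\<lambda>x. \<bar>v x\<bar>"
  have mem: "(?u, ?v) \<in> ?X"
    using uS vS nz \<Omega> p0 by (simp add: X_star_def X_space_def frac_sobolev0_cont_abs)
  have "gagliardo_pow s p ?u \<le> gagliardo_pow s p u"
    by (rule gagliardo_pow_mono) (use p0 in auto)
  then have Eu: "?Es ?u \<le> a" using Gu by (intro enn2real_leI a0) (rule order_trans)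
  have "gagliardo_pow t p ?v \<le> gagliardo_pow t p v"
    by (rule gagliardo_pow_mono) (use p0 in auto)
  then have Ev: "?Et ?v \<le> p * L - a" using Gv by (intro enn2real_leI b0) (rule order_trans)
  have "?Q ?u ?v = (?Es ?u + ?Et ?v) / p"
    unfolding Q_quot_def abs_idempotent Duv by (simp add: add_divide_distrib)
  also have "\<dots> \<le> L" using Eu Ev p0 by (simp add: divide_le_eq mult.commute)
  finally have "?Q ?u ?v \<le> L" .
  moreover have "L \<le> ?Q ?u ?v" unfolding L_def using mem p0 by (rule Lambda1_le)
  ultimately have "L = ?Q ?u ?v" by (rule antisym[rotated])
  then show ?thesis
    by (intro that[OF mem]) (use Duv in \<open>simp_all add: L_def\<close>)
qed

section \<open>Strict positivity of minimizers\<close>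

text \<open>The cut depends on |z| alone, so the kernel stays even; both the reflection of z and the
  swap of x and y rely on this. Integrating \<open>spow (p - 1) (w x - w y)\<close> against it
  gives, up to a constant, the fractional p-Laplacian of w before the principal value is
  taken.\<close>

definition truncated_kernel :: "real \<Rightarrow> real \<Rightarrow> real \<Rightarrow> 'a::euclidean_space \<Rightarrow> real" where
  "truncated_kernel \<sigma> p \<delta> z =
     (if \<delta> \<le> norm z then 1 / norm z powr (real DIM('a) + \<sigma> * p) else 0)"

lemma borel_measurable_truncated_kernel [measurable]:
  "truncated_kernel \<sigma> p \<delta> \<in> borel_measurable borel"
  unfolding truncated_kernel_def[abs_def] by measurable

lemma truncated_kernel_nonneg: "0 \<le> truncated_kernel \<sigma> p \<delta> z"
  and truncated_kernel_minus: "truncated_kernel \<sigma> p \<delta> (- z) = truncated_kernel \<sigma> p \<delta> z"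
  and truncated_kernel_le: "truncated_kernel \<sigma> p \<delta> (z :: 'a::euclidean_space)
    \<le> 1 / norm z powr (real DIM('a) + \<sigma> * p)"
  by (auto simp: truncated_kernel_def)

lemma truncated_kernel_tendsto:
  "(\<lambda>n. truncated_kernel \<sigma> p (1 / real (Suc n)) z)
     \<longlonglongrightarrow> 1 / norm (z :: 'a::euclidean_space) powr (real DIM('a) + \<sigma> * p)"
proof (cases "z = 0")
  case False
  then obtain N where N: "inverse (real (Suc N)) < norm z"
    using reals_Archimedean[of "norm z"] by auto
  have "truncated_kernel \<sigma> p (1 / real (Suc n)) z = 1 / norm z powr (real DIM('a) + \<sigma> * p)" if "N \<le> n" for n
  proof -
    have "1 / real (Suc n) \<le> inverse (real (Suc N))" using that by (simp add: field_simps)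
    then show ?thesis using N by (simp add: truncated_kernel_def)
  qed
  then show ?thesis
    by (intro tendsto_eventually eventually_sequentiallyI[of N])
qed (simp add: truncated_kernel_def)

text \<open>For |z| >= \<delta> and \<delta> <= 1 the numerator \<open>min 1 (norm z powr p)\<close>
  is at least \<delta>^p.\<close>

lemma truncated_kernel_le_capped:
  assumes "0 < \<delta>" "\<delta> \<le> 1" "0 < p"
  shows "truncated_kernel \<sigma> p \<delta> z \<le> \<delta> powr (- p) * capped_kernel \<sigma> p z"
proof (cases "\<delta> \<le> norm z")
  case True
  have "1 \<le> \<delta> powr (- p) * min 1 (norm z powr p)"
  proof -
    have "\<delta> powr p \<le> norm z powr p" using assms True by (intro powr_mono2) auto
    moreover have "\<delta> powr p \<le> 1" using assms by (simp add: powr_le1)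
    moreover have "\<delta> powr (- p) * \<delta> powr p = 1" using assms by (simp add: powr_add[symmetric])
    ultimately show ?thesis using mult_left_mono[of "\<delta> powr p" "min 1 (norm z powr p)" "\<delta> powr (- p)"] by simp
  qed
  then show ?thesis using True
    by (simp add: truncated_kernel_def capped_kernel_def divide_right_mono)
qed (simp add: truncated_kernel_def capped_kernel_nonneg)

lemma integrable_capped_kernel:
  assumes "0 < \<sigma>" "\<sigma> < 1" "0 < p"
  shows "integrable lborel (capped_kernel \<sigma> p :: 'a::euclidean_space \<Rightarrow> real)"
  using nn_integral_capped_kernel_finite[OF assms, where 'a='a]
  by (intro integrableI_bounded) (auto simp: capped_kernel_nonneg)

lemma integrable_truncated_kernel:
  assumes "0 < \<sigma>" "\<sigma> < 1" "0 < p" "0 < \<delta>" "\<delta> \<le> 1"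
  shows "integrable lborel (truncated_kernel \<sigma> p \<delta> :: 'a::euclidean_space \<Rightarrow> real)"
proof (rule Bochner_Integration.integrable_bound)
  show "integrable lborel (\<lambda>z::'a. \<delta> powr (- p) * capped_kernel \<sigma> p z)"
    using assms by (intro integrable_mult_right integrable_capped_kernel)
  show "AE z in lborel. norm (truncated_kernel \<sigma> p \<delta> z) \<le> norm (\<delta> powr (- p) * capped_kernel \<sigma> p (z :: 'a))"
    using truncated_kernel_le_capped[OF assms(4,5,3)]
    by (auto simp: truncated_kernel_nonneg capped_kernel_nonneg)
qed measurable

lemma integrable_lborel_reflect:
  fixes f :: "'a::euclidean_space \<Rightarrow> real"
  assumes "integrable lborel f"
  shows "integrable lborel (\<lambda>y. f (a - y))"
proof -
  have "integrable (distr lborel borel (\<lambda>y. a - y)) f" using assms by (simp add: lborel_distr_reflect)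
  then show ?thesis by (rule integrable_distr[rotated]) simp
qed

text \<open>
  Since \<open>p > 2\<close>, the signed power is locally Lipschitz; averaging the integrand over
  \<open>z\<close> and \<open>- z\<close> then gains a factor \<open>\<bar>z\<bar>\<close>, and the bound is uniform in the truncation radius. The
  paraboloid need not be smooth at the boundary of its support: a second difference bounded
  above suffices, and this survives taking the maximum with \<open>0\<close>.
\<close>

lemma paraboloid_nonlocal_le:
  fixes x a :: "'a::euclidean_space"
  assumes \<sigma>: "0 < \<sigma>" "\<sigma> < 1" and p: "2 < p" and r: "0 < r" "r \<le> 1" and x: "x \<in> ball a r"
    and \<delta>: "0 < \<delta>" "\<delta> \<le> 1"
  shows "(\<integral>y. spow (p - 1) (paraboloid a r x - paraboloid a r y) * truncated_kernel \<sigma> p \<delta> (x - y) \<partial>lborel)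
    \<le> (p * 2 powr p + 2) * (\<integral>(z::'a). capped_kernel \<sigma> p z \<partial>lborel)"
proof -
  let ?J = "spow (p - 1)" and ?P = "paraboloid a r"
  let ?T = "truncated_kernel \<sigma> p \<delta> :: 'a \<Rightarrow> real"
  \<comment> \<open>The summand p 2^p serves small |z|, where the second difference is used; the 2
    serves large |z|, where each signed power is at most 1.\<close>
  define C where "C = p * 2 powr p + 2"
  have C: "2 \<le> C" using p by (simp add: C_def)
  have intT: "integrable lborel ?T" using \<sigma> p \<delta> by (intro integrable_truncated_kernel) auto
  have le1: "\<bar>?P x - ?P y\<bar> \<le> 1" for y
  proof -
    have "r\<^sup>2 \<le> 1" using r by (simp add: power_le_one)
    then show ?thesis
      using paraboloid_nonneg[of a r x] paraboloid_nonneg[of a r y] paraboloid_le[of a r x] paraboloid_le[of a r y]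
      by linarith
  qed
  have J1: "\<bar>?J (?P x - ?P y)\<bar> \<le> 1" for y
    using abs_spow_le[OF _ le1[of y], of "p - 1"] p by simp
  define f where "f y = ?J (?P x - ?P y) * ?T (x - y)" for y
  have fm [measurable]: "f \<in> borel_measurable borel" unfolding f_def by measurable
  have f1: "f (x + z) = ?J (?P x - ?P (x + z)) * ?T z" and f2: "f (x - z) = ?J (?P x - ?P (x - z)) * ?T z" for z
    by (simp_all add: f_def truncated_kernel_minus)
  have i1: "integrable lborel (\<lambda>z. f (x + z))"
  proof (rule Bochner_Integration.integrable_bound[OF intT])
    show "AE z in lborel. norm (f (x + z)) \<le> norm (?T z)"
      using J1 by (auto simp: f1 abs_mult truncated_kernel_nonneg intro!: mult_left_le_one_le)
  qed measurable
  have i2: "integrable lborel (\<lambda>z. f (x - z))"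
  proof (rule Bochner_Integration.integrable_bound[OF intT])
    show "AE z in lborel. norm (f (x - z)) \<le> norm (?T z)"
      using J1 by (auto simp: f2 abs_mult truncated_kernel_nonneg intro!: mult_left_le_one_le)
  qed measurable
  have pt: "f (x + z) + f (x - z) \<le> C * capped_kernel \<sigma> p z" for z
  proof (cases "\<delta> \<le> norm z")
    case True
    let ?a = "?P x - ?P (x + z)" and ?b = "?P x - ?P (x - z)"
    have z: "0 < norm z" using True \<delta> by linarith
    have lip: "\<bar>?P x - ?P y\<bar> \<le> 2 * norm z" if "norm (x - y) = norm z" for y
    proof -
      have "\<bar>?P x - ?P y\<bar> \<le> 2 * r * norm (x - y)" using r by (intro paraboloid_lipschitz) auto
      also have "\<dots> \<le> 2 * norm z" using r that by (simp add: mult_right_le_one_le mult_left_le_one_le)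
      finally show ?thesis .
    qed
    \<comment> \<open>\<open>spow_add_le\<close> with exponent p - 1, M = 2|z| bounding both
      increments, and c = 2|z|^2 from the second difference; the powers of |z| combine to
      |z|^p.\<close>
    have "?J ?a + ?J ?b \<le> (p - 1) * (2 * norm z) powr (p - 1 - 1) * (2 * (norm z)\<^sup>2)"
      using p lip[of "x + z"] lip[of "x - z"] paraboloid_second_difference[OF x, of z]
      by (intro spow_add_le) auto
    also have "\<dots> = (p - 1) * 2 powr (p - 1) * norm z powr p"
    proof -
      have "(2 * norm z) powr (p - 1 - 1) * (2 * (norm z)\<^sup>2)
          = (2 powr (p - 2) * 2 powr 1) * (norm z powr (p - 2) * norm z powr 2)"
        using z by (simp add: powr_mult)
      also have "\<dots> = 2 powr (p - 1) * norm z powr p"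
        unfolding powr_add[symmetric] by simp
      finally show ?thesis by simp
    qed
    also have "\<dots> \<le> p * 2 powr p * norm z powr p"
      using p by (intro mult_right_mono mult_mono powr_mono) auto
    also have "\<dots> \<le> C * norm z powr p" by (simp add: C_def distrib_right)
    finally have 1: "?J ?a + ?J ?b \<le> C * norm z powr p" .
    have 2: "?J ?a + ?J ?b \<le> C" using J1[of "x + z"] J1[of "x - z"] C by linarith
    have "?J ?a + ?J ?b \<le> C * min 1 (norm z powr p)" using 1 2 by (simp add: min_def)
    then have "(?J ?a + ?J ?b) * ?T z \<le> C * min 1 (norm z powr p) * ?T z"
      by (intro mult_right_mono) (auto simp: truncated_kernel_nonneg)
    also have "\<dots> = C * capped_kernel \<sigma> p z"
      using True by (simp add: truncated_kernel_def capped_kernel_def)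
    finally show ?thesis by (simp add: f1 f2 distrib_right)
  next
    case False
    then have "?T z = 0" by (simp add: truncated_kernel_def)
    then show ?thesis using C by (simp add: f1 f2 capped_kernel_nonneg)
  qed
  \<comment> \<open>Translation and reflection invariance give two copies of the integral, one in x
    + z and one in x - z.\<close>
  have "2 * (\<integral>y. f y \<partial>lborel) = (\<integral>z. f (x + z) \<partial>lborel) + (\<integral>z. f (x - z) \<partial>lborel)"
    by (simp add: integral_lborel_translate integral_lborel_reflect)
  also have "\<dots> = (\<integral>z. f (x + z) + f (x - z) \<partial>lborel)"
    by (rule Bochner_Integration.integral_add[OF i1 i2, symmetric])
  also have "\<dots> \<le> (\<integral>(z::'a). C * capped_kernel \<sigma> p z \<partial>lborel)"
    using \<sigma> p by (intro integral_mono pt Bochner_Integration.integrable_add i1 i2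
        integrable_mult_right integrable_capped_kernel) auto
  also have "\<dots> = C * (\<integral>(z::'a). capped_kernel \<sigma> p z \<partial>lborel)" by simp
  finally have "2 * (\<integral>y. f y \<partial>lborel) \<le> C * (\<integral>(z::'a). capped_kernel \<sigma> p z \<partial>lborel)" .
  moreover have "0 \<le> C * (\<integral>(z::'a). capped_kernel \<sigma> p z \<partial>lborel)"
    using C by (intro mult_nonneg_nonneg Bochner_Integration.integral_nonneg) (auto simp: capped_kernel_nonneg)
  ultimately have "(\<integral>y. f y \<partial>lborel) \<le> C * (\<integral>(z::'a). capped_kernel \<sigma> p z \<partial>lborel)" by linarith
  then show ?thesis by (simp add: f_def C_def)
qed

section \<open>Comparing energies through the first variation\<close>

lemma frac_sobolev0_cont_bounded:
  fixes u :: "'a::euclidean_space \<Rightarrow> real"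
  assumes u: "u \<in> frac_sobolev0_cont \<sigma> p \<Omega>" and \<Omega>: "bounded \<Omega>"
  obtains W where "0 \<le> W" "\<And>x. \<bar>u x\<bar> \<le> W"
proof -
  have "compact (u ` closure \<Omega>)"
    using \<Omega> by (intro compact_continuous_image)
      (auto intro: continuous_on_subset[OF frac_sobolev0_contD(1)[OF u]])
  then obtain B where B: "\<And>x. x \<in> closure \<Omega> \<Longrightarrow> \<bar>u x\<bar> \<le> B"
    using compact_imp_bounded[of "u ` closure \<Omega>"] by (auto simp: bounded_iff)
  have "\<bar>u x\<bar> \<le> max B 0" for x
    using B[of x] frac_sobolev0_cont_eq_0[OF u, of x] by (cases "x \<in> closure \<Omega>") auto
  then show ?thesis by (intro that[of "max B 0"]) auto
qed

lemma integrable_frac_sobolev0_cont: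
  fixes u :: "'a::euclidean_space \<Rightarrow> real"
  assumes u: "u \<in> frac_sobolev0_cont \<sigma> p \<Omega>" and \<Omega>: "bounded \<Omega>"
  shows "integrable lborel u"
proof -
  have "integrable lborel (\<lambda>x. indicator (closure \<Omega>) x *\<^sub>R u x)"
    using \<Omega> by (intro borel_integrable_compact)
      (auto intro: continuous_on_subset[OF frac_sobolev0_contD(1)[OF u]])
  also have "(\<lambda>x. indicator (closure \<Omega>) x *\<^sub>R u x) = u"
    using frac_sobolev0_cont_eq_0[OF u] by (auto simp: fun_eq_iff indicator_def)
  finally show ?thesis .
qed

text \<open>
  For the truncated kernel the first variation can be split into two convergent integrals that are
  exchanged by swapping \<open>x\<close> and \<open>y\<close>; for the full kernel they may diverge.
\<close>

lemma gagliardo_truncated_variation_le: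
  fixes u w :: "'a::euclidean_space \<Rightarrow> real"
  assumes u: "u \<in> frac_sobolev0_cont \<sigma> p \<Omega>" and w: "w \<in> frac_sobolev0_cont \<sigma> p \<Omega>" and \<Omega>: "bounded \<Omega>"
    and \<sigma>: "0 < \<sigma>" "\<sigma> < 1" and p: "1 < p" and \<delta>: "0 < \<delta>" "\<delta> \<le> 1"
    and h: "\<And>x. u x \<le> w x"
    and inner: "\<And>x. u x < w x \<Longrightarrow>
      (\<integral>y. spow (p - 1) (w x - w y) * truncated_kernel \<sigma> p \<delta> (x - y) \<partial>lborel) \<le> - \<kappa>"
  shows "(\<integral>z. spow (p - 1) (w (fst z) - w (snd z))
        * ((w (fst z) - w (snd z)) - (u (fst z) - u (snd z))) * truncated_kernel \<sigma> p \<delta> (fst z - snd z)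
      \<partial>(lborel \<Otimes>\<^sub>M lborel)) \<le> - 2 * \<kappa> * (\<integral>x. w x - u x \<partial>lborel)"
proof -
  let ?J = "spow (p - 1)" and ?T = "truncated_kernel \<sigma> p \<delta> :: 'a \<Rightarrow> real"
  let ?P = "lborel \<Otimes>\<^sub>M lborel :: ('a \<times> 'a) measure"
  define h where "h x = w x - u x" for x
  note u' = frac_sobolev0_contD[OF u] and w' = frac_sobolev0_contD[OF w]
  note [measurable] = u'(2) w'(2)
  have hm [measurable]: "h \<in> borel_measurable borel" unfolding h_def by measurable
  have h0: "0 \<le> h x" for x using h[of x] by (simp add: h_def)
  have hi: "integrable lborel h"
    unfolding h_def by (intro Bochner_Integration.integrable_diff integrable_frac_sobolev0_cont[OF u \<Omega>]
        integrable_frac_sobolev0_cont[OF w \<Omega>])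
  have intT: "integrable lborel ?T" using \<sigma> p \<delta> by (intro integrable_truncated_kernel) auto
  obtain W where W: "0 \<le> W" "\<And>x. \<bar>w x\<bar> \<le> W" using frac_sobolev0_cont_bounded[OF w \<Omega>] by blast
  have JW: "\<bar>?J (w x - w y)\<bar> \<le> (2 * W) powr (p - 1)" for x y
    using W(2)[of x] W(2)[of y] p by (intro abs_spow_le) auto
  \<comment> \<open>Half of the first variation. As the signed power is odd and the kernel even, the
    other half is \<open>G\<close> with its arguments exchanged.\<close>
  define G where "G z = h (fst z) * (?J (w (fst z) - w (snd z)) * ?T (fst z - snd z))" for z
  have Gm [measurable]: "G \<in> borel_measurable ?P" unfolding G_def by measurable
  have T2: "integrable ?P (\<lambda>z. h (fst z) * ?T (fst z - snd z))"
  proof (rule lborel_pair.Fubini_integrable)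
    have "(\<integral>y. norm (h x * ?T (x - y)) \<partial>lborel) = h x * (\<integral>y. ?T y \<partial>lborel)" for x
      using h0[of x] integral_lborel_reflect[of ?T x] by (simp add: abs_mult truncated_kernel_nonneg)
    then show "integrable lborel (\<lambda>x. \<integral>y. norm (h (fst (x, y)) * ?T (fst (x, y) - snd (x, y))) \<partial>lborel)"
      using hi by simp
    show "AE x in lborel. integrable lborel (\<lambda>y. h (fst (x, y)) * ?T (fst (x, y) - snd (x, y)))"
      by (auto intro!: integrable_lborel_reflect intT)
  qed measurable
  have Gi: "integrable ?P G"
  proof (rule Bochner_Integration.integrable_bound)
    show "integrable ?P (\<lambda>z. (2 * W) powr (p - 1) * (h (fst z) * ?T (fst z - snd z)))"
      using T2 by (rule integrable_mult_right)
    show "AE z in ?P. norm (G z) \<le> norm ((2 * W) powr (p - 1) * (h (fst z) * ?T (fst z - snd z)))"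
    proof (rule AE_I2)
      fix z
      have "\<bar>G z\<bar> = \<bar>?J (w (fst z) - w (snd z))\<bar> * (h (fst z) * ?T (fst z - snd z))"
        using h0[of "fst z"] by (simp add: G_def abs_mult truncated_kernel_nonneg)
      also have "\<dots> \<le> (2 * W) powr (p - 1) * (h (fst z) * ?T (fst z - snd z))"
        using h0[of "fst z"] by (intro mult_right_mono JW) (auto simp: truncated_kernel_nonneg)
      finally show "norm (G z) \<le> norm ((2 * W) powr (p - 1) * (h (fst z) * ?T (fst z - snd z)))"
        by simp
    qed
  qed measurable
  have swap: "integrable ?P (\<lambda>z. G (snd z, fst z))" "(\<integral>z. G (snd z, fst z) \<partial>?P) = (\<integral>z. G z \<partial>?P)"
    using lborel_pair.integrable_product_swap[OF Gi] lborel_pair.integral_product_swap[OF Gm]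
    by (simp_all add: case_prod_unfold)
  have eq: "?J (w (fst z) - w (snd z)) * ((w (fst z) - w (snd z)) - (u (fst z) - u (snd z))) * ?T (fst z - snd z)
      = G z + G (snd z, fst z)" for z
  proof -
    have "?J (w (snd z) - w (fst z)) = - ?J (w (fst z) - w (snd z))"
      using spow_minus[of "p - 1" "w (fst z) - w (snd z)"] by simp
    moreover have "?T (snd z - fst z) = ?T (fst z - snd z)"
      using truncated_kernel_minus[of \<sigma> p \<delta> "fst z - snd z"] by simp
    ultimately show ?thesis by (simp add: G_def h_def algebra_simps)
  qed
  have "(\<integral>z. ?J (w (fst z) - w (snd z)) * ((w (fst z) - w (snd z)) - (u (fst z) - u (snd z)))
      * ?T (fst z - snd z) \<partial>?P) = 2 * (\<integral>z. G z \<partial>?P)"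
    unfolding eq Bochner_Integration.integral_add[OF Gi swap(1)] swap(2) by simp
  also have "(\<integral>z. G z \<partial>?P) = (\<integral>x. \<integral>y. G (x, y) \<partial>lborel \<partial>lborel)"
    by (rule lborel_pair.integral_fst'[OF Gi, symmetric])
  also have "\<dots> \<le> (\<integral>x. h x * (- \<kappa>) \<partial>lborel)"
  proof (intro integral_mono lborel_pair.integrable_fst'[OF Gi] integrable_mult_left hi)
    fix x
    have "(\<integral>y. G (x, y) \<partial>lborel) = h x * (\<integral>y. ?J (w x - w y) * ?T (x - y) \<partial>lborel)"
      by (simp add: G_def)
    also have "\<dots> \<le> h x * (- \<kappa>)"
    \<comment> \<open>Where u x = w x the weight h x vanishes, so \<open>inner\<close> is called for
      only where w lies strictly above u.\<close>
    proof (cases "u x < w x")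
      case True
      then show ?thesis using h0[of x] by (intro mult_left_mono inner)
    next
      case False
      then have "h x = 0" using h0[of x] by (simp add: h_def)
      then show ?thesis by simp
    qed
    finally show "(\<integral>y. G (x, y) \<partial>lborel) \<le> h x * (- \<kappa>)" .
  qed
  also have "\<dots> = - \<kappa> * (\<integral>x. h x \<partial>lborel)" by simp
  finally show ?thesis by (simp add: h_def)
qed

text \<open>Integrating the tangent inequality at w bounds the energy of w by that of u plus p times
  the first variation. The bound in \<open>inner\<close> does not depend on \<delta>, so it survives
  \<delta> -> 0 by dominated convergence: taken as a whole, the first variation is dominated by the
  energy densities of u and w. The threshold \<eta> admits estimates that hold only while the cut
  stays clear of a distant set.\<close>

lemma gagliardo_decrease:
  fixes u w :: "'a::euclidean_space \<Rightarrow> real"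
  assumes u: "u \<in> frac_sobolev0_cont \<sigma> p \<Omega>" and w: "w \<in> frac_sobolev0_cont \<sigma> p \<Omega>" and \<Omega>: "bounded \<Omega>"
    and \<sigma>: "0 < \<sigma>" "\<sigma> < 1" and p: "1 < p" and \<eta>: "0 < \<eta>"
    and h: "\<And>x. u x \<le> w x"
    and inner: "\<And>x \<delta>. u x < w x \<Longrightarrow> 0 < \<delta> \<Longrightarrow> \<delta> \<le> 1 \<Longrightarrow> \<delta> \<le> \<eta> \<Longrightarrow>
      (\<integral>y. spow (p - 1) (w x - w y) * truncated_kernel \<sigma> p \<delta> (x - y) \<partial>lborel) \<le> - \<kappa>"
  shows "enn2real (gagliardo_pow \<sigma> p w)
    \<le> enn2real (gagliardo_pow \<sigma> p u) - 2 * p * \<kappa> * (\<integral>x. w x - u x \<partial>lborel)"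
proof -
  let ?J = "spow (p - 1)" and ?T = "\<lambda>\<delta>. truncated_kernel \<sigma> p \<delta> :: 'a \<Rightarrow> real"
  let ?P = "lborel \<Otimes>\<^sub>M lborel :: ('a \<times> 'a) measure"
  let ?E = "real DIM('a) + \<sigma> * p"
  let ?H = "\<integral>x. w x - u x \<partial>lborel"
  note u' = frac_sobolev0_contD[OF u] and w' = frac_sobolev0_contD[OF w]
  note [measurable] = u'(2) w'(2)
  define A where "A z = ?J (w (fst z) - w (snd z)) * ((w (fst z) - w (snd z)) - (u (fst z) - u (snd z)))" for z
  have Am [measurable]: "A \<in> borel_measurable ?P" unfolding A_def by measurable
  define F where "F z = A z * (1 / norm (fst z - snd z) powr ?E)" for z
  have Fm [measurable]: "F \<in> borel_measurable ?P" unfolding F_def by measurable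
  define D where "D z = 2 * gagliardo_density \<sigma> p w z + gagliardo_density \<sigma> p u z" for z
  have iu: "integrable ?P (gagliardo_density \<sigma> p u)" and iw: "integrable ?P (gagliardo_density \<sigma> p w)"
    using u' w' by (auto intro: integrable_gagliardo_density)
  have Di: "integrable ?P D" unfolding D_def
    by (intro Bochner_Integration.integrable_add integrable_mult_right iu iw)
  have AD: "\<bar>A z\<bar> * (1 / norm (fst z - snd z) powr ?E) \<le> D z" for z
  proof -
    have "\<bar>A z\<bar> \<le> 2 * \<bar>w (fst z) - w (snd z)\<bar> powr p + \<bar>u (fst z) - u (snd z)\<bar> powr p"
      unfolding A_def by (rule abs_spow_mult_diff_le[OF p])
    then have "\<bar>A z\<bar> * (1 / norm (fst z - snd z) powr ?E)
      \<le> (2 * \<bar>w (fst z) - w (snd z)\<bar> powr p + \<bar>u (fst z) - u (snd z)\<bar> powr p) * (1 / norm (fst z - snd z) powr ?E)"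
      by (intro mult_right_mono) auto
    then show ?thesis by (simp add: D_def gagliardo_density_def add_divide_distrib)
  qed
  define Fn where "Fn n z = A z * ?T (1 / real (Suc n)) (fst z - snd z)" for n z
  have Fnm [measurable]: "Fn n \<in> borel_measurable ?P" for n unfolding Fn_def by measurable
  have Fi: "integrable ?P F"
  proof (rule Bochner_Integration.integrable_bound[OF Di])
    show "AE z in ?P. norm (F z) \<le> norm (D z)"
      using AD by (intro AE_I2) (auto simp: F_def abs_mult intro: order_trans[OF _ abs_ge_self])
  qed measurable
  have lim: "(\<lambda>n. \<integral>z. Fn n z \<partial>?P) \<longlonglongrightarrow> (\<integral>z. F z \<partial>?P)"
  proof (rule integral_dominated_convergence[where w=D])
    show "AE z in ?P. (\<lambda>n. Fn n z) \<longlonglongrightarrow> F z"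
      unfolding Fn_def F_def by (intro AE_I2 tendsto_mult_left truncated_kernel_tendsto)
    fix n
    show "AE z in ?P. norm (Fn n z) \<le> D z"
    proof (rule AE_I2)
      fix z
      have "\<bar>Fn n z\<bar> = \<bar>A z\<bar> * ?T (1 / real (Suc n)) (fst z - snd z)"
        by (simp add: Fn_def abs_mult truncated_kernel_nonneg)
      also have "\<dots> \<le> \<bar>A z\<bar> * (1 / norm (fst z - snd z) powr ?E)"
        by (intro mult_left_mono truncated_kernel_le) auto
      also have "\<dots> \<le> D z" by (rule AD)
      finally show "norm (Fn n z) \<le> D z" by simp
    qed
  qed (use Di in simp_all)
  obtain N where N: "inverse (real (Suc N)) < \<eta>" using reals_Archimedean[OF \<eta>] by blast
  have "(\<integral>z. Fn n z \<partial>?P) \<le> - 2 * \<kappa> * ?H" if "N \<le> n" for n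
  proof -
    have "1 / real (Suc n) \<le> inverse (real (Suc N))" using that by (simp add: field_simps)
    with N have "1 / real (Suc n) \<le> \<eta>" by linarith
    then show ?thesis
      unfolding Fn_def A_def using p \<sigma> h
      by (intro gagliardo_truncated_variation_le[OF u w \<Omega>] inner) auto
  qed
  then have FH: "(\<integral>z. F z \<partial>?P) \<le> - 2 * \<kappa> * ?H"
    by (intro LIMSEQ_le_const2[OF lim]) auto
  have "(\<integral>z. gagliardo_density \<sigma> p w z \<partial>?P) \<le> (\<integral>z. gagliardo_density \<sigma> p u z + p * F z \<partial>?P)"
  proof (intro integral_mono iw Bochner_Integration.integrable_add iu integrable_mult_right Fi)
    fix z
    have "\<bar>w (fst z) - w (snd z)\<bar> powr p \<le> \<bar>u (fst z) - u (snd z)\<bar> powr p + p * A z"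
      unfolding A_def by (rule powr_abs_tangent_le[OF p])
    then have "\<bar>w (fst z) - w (snd z)\<bar> powr p / norm (fst z - snd z) powr ?E
       \<le> (\<bar>u (fst z) - u (snd z)\<bar> powr p + p * A z) / norm (fst z - snd z) powr ?E"
      by (intro divide_right_mono) auto
    then show "gagliardo_density \<sigma> p w z \<le> gagliardo_density \<sigma> p u z + p * F z"
      by (simp add: gagliardo_density_def F_def add_divide_distrib)
  qed
  also have "\<dots> = (\<integral>z. gagliardo_density \<sigma> p u z \<partial>?P) + p * (\<integral>z. F z \<partial>?P)"
    by (subst Bochner_Integration.integral_add[OF iu integrable_mult_right[OF Fi]]) simp
  also have "p * (\<integral>z. F z \<partial>?P) \<le> p * (- 2 * \<kappa> * ?H)"
    using p FH by (intro mult_left_mono) auto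
  finally show ?thesis
    using u' w' by (simp add: integral_gagliardo_density)
qed

lemma integral_continuous_pos:
  fixes h :: "'a::euclidean_space \<Rightarrow> real"
  assumes c: "continuous_on UNIV h" and i: "integrable lborel h" and h: "\<And>x. 0 \<le> h x" and x: "0 < h a"
  shows "0 < (\<integral>x. h x \<partial>lborel)"
proof (rule ccontr)
  assume "\<not> 0 < (\<integral>x. h x \<partial>lborel)"
  moreover have "0 \<le> (\<integral>x. h x \<partial>lborel)" by (rule Bochner_Integration.integral_nonneg) (rule h)
  ultimately have "(\<integral>x. h x \<partial>lborel) = 0" by linarith
  then have "AE x in lborel. h x = 0" using integral_nonneg_eq_0_iff_AE[OF i] h by simp
  then have "h a = 0" by (intro continuous_AE_zero_imp_zero[OF c, of "{}"]) simp_all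
  with x show False by simp
qed

text \<open>At every x with u x < w x the competitor w touches \<epsilon>\<phi> from above, so each
  increment w x - w y is at most that of \<epsilon>\<phi>; for y near x1 it is also below a fixed
  negative number. Since \<phi> vanishes at x1, w keeps the value of u there and is admissible in
  \<open>min\<close>.\<close>

lemma frac_sobolev0_minimizer_pos:
  fixes u :: "'a::euclidean_space \<Rightarrow> real"
  assumes \<Omega>: "open \<Omega>" "bounded \<Omega>" and \<sigma>: "0 < \<sigma>" "\<sigma> < 1" and p: "2 < p"
    and u: "u \<in> frac_sobolev0_cont \<sigma> p \<Omega>" and u0: "\<And>x. 0 \<le> u x" and x1: "u x1 \<noteq> 0"
    and min: "\<And>w. w \<in> frac_sobolev0_cont \<sigma> p \<Omega> \<Longrightarrow> w x1 = u x1 \<Longrightarrow>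
      enn2real (gagliardo_pow \<sigma> p u) \<le> enn2real (gagliardo_pow \<sigma> p w)"
    and x0: "x0 \<in> \<Omega>"
  shows "0 < u x0"
proof (rule ccontr)
  assume "\<not> 0 < u x0"
  with u0[of x0] have ux0: "u x0 = 0" by linarith
  let ?J = "spow (p - 1)" and ?T = "\<lambda>\<delta>. truncated_kernel \<sigma> p \<delta> :: 'a \<Rightarrow> real"
  let ?E = "real DIM('a) + \<sigma> * p"
  note u' = frac_sobolev0_contD[OF u]
  define c where "c = u x1"
  have c: "0 < c" using u0[of x1] x1 by (simp add: c_def)
  define d where "d = norm (x0 - x1)"
  have d: "0 < d" using ux0 x1 by (auto simp: d_def)
  obtain e1 where e1: "0 < e1" "\<And>y. dist y x1 < e1 \<Longrightarrow> dist (u y) (u x1) < c / 2"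
    using u'(1) c by (metis UNIV_I continuous_on_iff half_gt_zero)
  \<comment> \<open>Radii of at most d/4 keep points of the balls around x0 and x1 between d/2 and
    2d apart: the first bound shields this part of the kernel from cuts \<delta> <= d/2, the second
    bounds the kernel from below.\<close>
  define \<rho> where "\<rho> = min e1 (d / 4)"
  have \<rho>: "0 < \<rho>" "\<rho> \<le> d / 4" using e1 d by (auto simp: \<rho>_def)
  have uB: "c / 2 \<le> u y" if "y \<in> ball x1 \<rho>" for y
    using e1(2)[of y] that by (auto simp: \<rho>_def c_def dist_commute dist_real_def abs_if split: if_splits)
  obtain e2 where e2: "0 < e2" "ball x0 e2 \<subseteq> \<Omega>" using \<Omega>(1) x0 by (meson open_contains_ball)
  define r where "r = min (min e2 1) (d / 4)"
  have r: "0 < r" "r \<le> 1" "r \<le> d / 4" "ball x0 r \<subseteq> \<Omega>" using e2 d by (auto simp: r_def)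
  define \<phi> where "\<phi> = paraboloid x0 r"
  have \<phi>: "0 \<le> \<phi> x" "\<phi> x \<le> 1" for x
    using paraboloid_nonneg[of x0 r x] paraboloid_le[of x0 r x] r power_le_one[of r 2] by (auto simp: \<phi>_def)
  have \<phi>0: "\<phi> x = 0" if "x \<notin> ball x0 r" for x
    using r that by (auto simp: \<phi>_def intro: paraboloid_eq_0 simp del: mem_ball)
  have \<phi>m [measurable]: "\<phi> \<in> borel_measurable borel" by (simp add: \<phi>_def)
  have dist: "d / 2 \<le> norm (x - y)" "norm (x - y) \<le> 2 * d" if "x \<in> ball x0 r" "y \<in> ball x1 \<rho>" for x y
  proof -
    have "norm (x - x0) < d / 4" "norm (y - x1) < d / 4"
      using that r \<rho> by (auto simp: dist_norm norm_minus_commute)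
    moreover have "x0 - x1 = - (x - x0) + (x - y) + (y - x1)" "x - y = (x - x0) + (x0 - x1) + - (y - x1)" by simp_all
    then have "d \<le> norm (x - x0) + norm (x - y) + norm (y - x1)" "norm (x - y) \<le> norm (x - x0) + d + norm (y - x1)"
      unfolding d_def by (metis norm_minus_cancel norm_triangle_ineq norm_triangle_le add_mono order_refl)+
    ultimately show "d / 2 \<le> norm (x - y)" "norm (x - y) \<le> 2 * d" by linarith+
  qed
  define I where "I = (p * 2 powr p + 2) * (\<integral>(z::'a). capped_kernel \<sigma> p z \<partial>lborel)"
  have I: "0 \<le> I" unfolding I_def
    using p by (intro mult_nonneg_nonneg Bochner_Integration.integral_nonneg) (auto simp: capped_kernel_nonneg)
  \<comment> \<open>A lower bound for the mass that the kernel, centred at any point of the ball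
    around x0, puts on the ball around x1.\<close>
  define m where "m = measure lborel (ball x1 \<rho>) / (2 * d) powr ?E"
  have m: "0 < m" using \<rho> d by (simp add: m_def measure_lborel_ball_pos)
  \<comment> \<open>Half of the guaranteed gain; the other half pays for the contribution of
    \<phi>.\<close>
  define \<kappa> where "\<kappa> = (c / 4) powr (p - 1) * m / 2"
  have \<kappa>: "0 < \<kappa>" using c m by (simp add: \<kappa>_def)
  \<comment> \<open>The entry c/4 leaves a gap of c/4 below the values u >= c/2 near x1. The other
    entry ensures \<epsilon>^(p-1) I <= \<kappa>, with I + 1 in place of I because only I >= 0 is
    known.\<close>
  define \<epsilon> where "\<epsilon> = min (c / 4) ((\<kappa> / (I + 1)) powr (1 / (p - 1)))"
  have \<epsilon>: "0 < \<epsilon>" "\<epsilon> \<le> c / 4" using c \<kappa> I by (auto simp: \<epsilon>_def)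
  have \<epsilon>I: "\<epsilon> powr (p - 1) * I \<le> \<kappa>"
  proof -
    have "\<epsilon> powr (p - 1) \<le> ((\<kappa> / (I + 1)) powr (1 / (p - 1))) powr (p - 1)"
      using \<epsilon> p by (intro powr_mono2) (auto simp: \<epsilon>_def)
    also have "\<dots> = \<kappa> / (I + 1)" using \<kappa> I p by (simp add: powr_powr)
    finally have "\<epsilon> powr (p - 1) * I \<le> \<kappa> / (I + 1) * I" using I by (rule mult_right_mono)
    also have "\<dots> \<le> \<kappa>" using \<kappa> I by (simp add: field_simps)
    finally show ?thesis .
  qed
  define w where "w x = max (u x) (\<epsilon> * \<phi> x)" for x
  have \<phi>S: "(\<lambda>x. \<epsilon> * \<phi> x) \<in> frac_sobolev0_cont \<sigma> p \<Omega>"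
    unfolding \<phi>_def using r \<Omega> \<sigma> p
    by (intro frac_sobolev0_cont_cmult paraboloid_in_frac_sobolev0_cont) auto
  note \<phi>' = frac_sobolev0_contD[OF \<phi>S]
  have wS: "w \<in> frac_sobolev0_cont \<sigma> p \<Omega>"
  proof (rule frac_sobolev0_contI)
    show "continuous_on UNIV w" unfolding w_def by (intro continuous_on_max u' \<phi>')
    show "AE x in lborel. x \<notin> \<Omega> \<longrightarrow> w x = 0"
      using u'(4) \<phi>'(4) by eventually_elim (auto simp: w_def)
    show "gagliardo_pow \<sigma> p w < \<infinity>"
      unfolding w_def using p by (intro gagliardo_pow_max_finite u' \<phi>') auto
  qed (use \<Omega> p in auto)
  note w' = frac_sobolev0_contD[OF wS]
  note [measurable] = w'(2)
  have "x1 \<notin> ball x0 r" using r d by (auto simp: d_def dist_norm)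
  then have wx1: "w x1 = u x1" using u0[of x1] by (simp add: w_def \<phi>0)
  have decr: "enn2real (gagliardo_pow \<sigma> p w)
      \<le> enn2real (gagliardo_pow \<sigma> p u) - 2 * p * \<kappa> * (\<integral>x. w x - u x \<partial>lborel)"
  proof (rule gagliardo_decrease[OF u wS \<Omega>(2) \<sigma>, where \<eta>="d / 2"])
    fix x :: 'a and \<delta> :: real assume x: "u x < w x" and \<delta>: "0 < \<delta>" "\<delta> \<le> 1" "\<delta> \<le> d / 2"
    have intT: "integrable lborel (\<lambda>y. ?T \<delta> (x - y))"
      using \<sigma> p \<delta> by (intro integrable_lborel_reflect integrable_truncated_kernel) auto
    have wx: "w x = \<epsilon> * \<phi> x" using x by (simp add: w_def max_def split: if_splits)
    have xb: "x \<in> ball x0 r"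
    proof (rule ccontr)
      assume "x \<notin> ball x0 r"
      then show False using \<phi>0[of x] wx x u0[of x] by simp
    qed
    have wx_le: "w x \<le> c / 4"
    proof -
      have "\<epsilon> * \<phi> x \<le> \<epsilon> * 1" using \<epsilon> \<phi> by (intro mult_left_mono) auto
      then show ?thesis using wx \<epsilon> by linarith
    qed
    let ?B = "indicator (ball x1 \<rho>) :: 'a \<Rightarrow> real"
    have J: "?J (w x - w y) \<le> \<epsilon> powr (p - 1) * ?J (\<phi> x - \<phi> y) - (c / 4) powr (p - 1) * ?B y" for y
    proof (cases "y \<in> ball x1 \<rho>")
      case True
      \<comment> \<open>A common point y of the two balls would give d/2 <= |y - y| = 0.\<close>
      have "y \<notin> ball x0 r" using dist(1)[of y y] True d by auto
      then have 0: "\<phi> y = 0" by (rule \<phi>0)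
      have "c / 2 \<le> w y" using uB[OF True] by (simp add: w_def)
      then have "?J (w x - w y) \<le> ?J (- (c / 4))"
        using wx_le p by (intro spow_mono) auto
      also have "\<dots> = - ((c / 4) powr (p - 1))" using c by (simp add: spow_def)
      also have "\<dots> \<le> \<epsilon> powr (p - 1) * ?J (\<phi> x - \<phi> y) - (c / 4) powr (p - 1)"
      proof -
        \<comment> \<open>Being nonnegative, the \<phi> term may be added for free, which yields a
          single bound for all y.\<close>
        have "0 \<le> ?J (\<phi> x - \<phi> y)" using \<phi>(1)[of x] 0 by (auto simp: spow_def sgn_if)
        then show ?thesis by simp
      qed
      finally show ?thesis using True by simp
    next
      case False
      have "\<epsilon> * \<phi> y \<le> w y" by (simp add: w_def)
      then have "?J (w x - w y) \<le> ?J (\<epsilon> * (\<phi> x - \<phi> y))"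
        using p by (intro spow_mono) (auto simp: wx right_diff_distrib)
      also have "\<dots> = \<epsilon> powr (p - 1) * ?J (\<phi> x - \<phi> y)" using \<epsilon> by (intro spow_mult) auto
      finally show ?thesis using False by simp
    qed
    obtain W where W: "0 \<le> W" "\<And>x. \<bar>w x\<bar> \<le> W" using frac_sobolev0_cont_bounded[OF wS \<Omega>(2)] by blast
    have i1: "integrable lborel (\<lambda>y. ?J (w x - w y) * ?T \<delta> (x - y))"
    proof (rule Bochner_Integration.integrable_bound[OF integrable_mult_right[OF intT, of "(2 * W) powr (p - 1)"]])
      have "\<bar>?J (w x - w y)\<bar> \<le> (2 * W) powr (p - 1)" for y
        using W(2)[of x] W(2)[of y] p by (intro abs_spow_le) auto
      then show "AE y in lborel. norm (?J (w x - w y) * ?T \<delta> (x - y)) \<le> norm ((2 * W) powr (p - 1) * ?T \<delta> (x - y))"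
        by (intro AE_I2) (simp add: abs_mult truncated_kernel_nonneg mult_right_mono)
    qed measurable
    have i2: "integrable lborel (\<lambda>y. ?J (\<phi> x - \<phi> y) * ?T \<delta> (x - y))"
    proof (rule Bochner_Integration.integrable_bound[OF intT])
      have "\<bar>?J (\<phi> x - \<phi> y)\<bar> \<le> 1 powr (p - 1)" for y
        using \<phi>[of x] \<phi>[of y] p by (intro abs_spow_le) auto
      then have "\<bar>?J (\<phi> x - \<phi> y)\<bar> \<le> 1" for y by simp
      then show "AE y in lborel. norm (?J (\<phi> x - \<phi> y) * ?T \<delta> (x - y)) \<le> norm (?T \<delta> (x - y))"
        by (intro AE_I2) (simp add: abs_mult truncated_kernel_nonneg mult_left_le_one_le)
    qed measurable
    have i3: "integrable lborel (\<lambda>y. ?B y * ?T \<delta> (x - y))"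
      by (rule Bochner_Integration.integrable_bound[OF intT]) (auto simp: indicator_def)
    have "(\<integral>y. ?J (w x - w y) * ?T \<delta> (x - y) \<partial>lborel)
      \<le> (\<integral>y. \<epsilon> powr (p - 1) * (?J (\<phi> x - \<phi> y) * ?T \<delta> (x - y)) - (c / 4) powr (p - 1) * (?B y * ?T \<delta> (x - y)) \<partial>lborel)"
    proof (intro integral_mono i1 Bochner_Integration.integrable_diff integrable_mult_right i2 i3)
      fix y
      show "?J (w x - w y) * ?T \<delta> (x - y)
        \<le> \<epsilon> powr (p - 1) * (?J (\<phi> x - \<phi> y) * ?T \<delta> (x - y)) - (c / 4) powr (p - 1) * (?B y * ?T \<delta> (x - y))"
        using mult_right_mono[OF J[of y] truncated_kernel_nonneg[of \<sigma> p \<delta> "x - y"]]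
        by (simp add: left_diff_distrib mult.assoc)
    qed
    also have "\<dots> = \<epsilon> powr (p - 1) * (\<integral>y. ?J (\<phi> x - \<phi> y) * ?T \<delta> (x - y) \<partial>lborel)
        - (c / 4) powr (p - 1) * (\<integral>y. ?B y * ?T \<delta> (x - y) \<partial>lborel)"
      by (subst Bochner_Integration.integral_diff[OF integrable_mult_right[OF i2] integrable_mult_right[OF i3]]) simp
    also have "\<dots> \<le> \<epsilon> powr (p - 1) * I - (c / 4) powr (p - 1) * m"
    proof (intro diff_mono mult_left_mono)
      show "(\<integral>y. ?J (\<phi> x - \<phi> y) * ?T \<delta> (x - y) \<partial>lborel) \<le> I"
        unfolding \<phi>_def I_def using \<sigma> p r \<delta> xb by (intro paraboloid_nonlocal_le)
      have "m = (\<integral>y. ?B y * (1 / (2 * d) powr ?E) \<partial>lborel)" by (simp add: m_def)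
      also have "\<dots> \<le> (\<integral>y. ?B y * ?T \<delta> (x - y) \<partial>lborel)"
      proof (intro integral_mono i3 integrable_mult_left integrable_indicator_ball_lborel)
        fix y
        show "?B y * (1 / (2 * d) powr ?E) \<le> ?B y * ?T \<delta> (x - y)"
        proof (cases "y \<in> ball x1 \<rho>")
          case True
          have "norm (x - y) powr ?E \<le> (2 * d) powr ?E"
            using dist[OF xb True] \<sigma> p by (intro powr_mono2) (auto intro: add_nonneg_nonneg)
          moreover have "0 < norm (x - y) powr ?E" using dist[OF xb True] d by auto
          ultimately have "1 / (2 * d) powr ?E \<le> 1 / norm (x - y) powr ?E"
            by (intro frac_le) simp_all
          then show ?thesis using dist[OF xb True] \<delta> True by (simp add: truncated_kernel_def)
        qed simp
      qed
      finally show "m \<le> (\<integral>y. ?B y * ?T \<delta> (x - y) \<partial>lborel)" .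
    qed auto
    also have "\<dots> \<le> - \<kappa>" using \<epsilon>I by (simp add: \<kappa>_def)
    finally show "(\<integral>y. ?J (w x - w y) * ?T \<delta> (x - y) \<partial>lborel) \<le> - \<kappa>" .
  qed (use p d in \<open>auto simp: w_def\<close>)
  have "0 < (\<integral>x. w x - u x \<partial>lborel)"
  proof (rule integral_continuous_pos[where a=x0])
    show "continuous_on UNIV (\<lambda>x. w x - u x)" by (intro continuous_on_diff w' u')
    show "integrable lborel (\<lambda>x. w x - u x)"
      by (intro Bochner_Integration.integrable_diff integrable_frac_sobolev0_cont[OF u \<Omega>(2)]
          integrable_frac_sobolev0_cont[OF wS \<Omega>(2)])
    show "0 < w x0 - u x0" using ux0 \<epsilon> r by (simp add: w_def \<phi>_def paraboloid_center less_max_iff_disj)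
  qed (simp add: w_def)
  then have "0 < 2 * p * \<kappa> * (\<integral>x. w x - u x \<partial>lborel)" using p \<kappa> by simp
  with decr min[OF wS wx1] show False by linarith
qed

theorem theorem9:
  fixes \<Omega> :: "'a::euclidean_space set"
    and s t \<theta> :: real
    and x1 x2 :: 'a
    and \<alpha> \<beta> :: "real \<Rightarrow> real"
  assumes "smooth_bounded_domain \<Omega>"
    and "0 < s" and "s \<le> t" and "t < 1"
    and "x1 \<in> \<Omega>" and "x2 \<in> \<Omega>" and "x1 \<noteq> x2"
    and "\<alpha> \<in> {real DIM('a) / s <..} \<rightarrow> {1<..}"
    and "\<beta> \<in> {real DIM('a) / s <..} \<rightarrow> {1<..}"
    and "\<forall>p\<in>{real DIM('a) / s <..}. \<alpha> p + \<beta> p = p"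
    and "\<theta> \<in> {0<..<1}"
    and "((\<lambda>p. \<alpha> p / p) \<longlongrightarrow> \<theta>) at_top"
  shows "\<forall>p\<in>{real DIM('a) / s <..}.
    Lambda1 s t \<Omega> \<alpha> \<beta> x1 x2 p > 0 \<and>
    (\<exists>u v. (u, v) \<in> X_star s t p \<Omega> x1 x2 \<and>
       (\<forall>x\<in>\<Omega>. u x > 0) \<and> (\<forall>x\<in>\<Omega>. v x > 0) \<and>
       \<bar>u x1\<bar> powr \<alpha> p * \<bar>v x2\<bar> powr \<beta> p = 1 \<and>
       Lambda1 s t \<Omega> \<alpha> \<beta> x1 x2 p = Q_quot s t \<alpha> \<beta> x1 x2 p u v)"
proof
  fix p assume "p \<in> {real DIM('a) / s <..}"
  then have ps: "real DIM('a) / s < p" by simp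
  have \<Omega>: "open \<Omega>" "bounded \<Omega>" using assms(1) by (auto simp: smooth_bounded_domain_def)
  have st: "0 < s" "s < 1" "0 < t" "t < 1" using assms by auto
  have ab: "1 < \<alpha> p" "1 < \<beta> p" "\<alpha> p + \<beta> p = p" using assms(8-10) ps by auto
  then have p: "2 < p" by linarith
  \<comment> \<open>The order s <= t carries the Morrey condition on p from s to t.\<close>
  have "real DIM('a) / t \<le> real DIM('a) / s" using st assms(3) by (intro divide_left_mono) auto
  then have pt: "real DIM('a) / t < p" using ps by linarith
  let ?X = "X_star s t p \<Omega> x1 x2" and ?Q = "Q_quot s t \<alpha> \<beta> x1 x2 p"
  let ?L = "Lambda1 s t \<Omega> \<alpha> \<beta> x1 x2 p"
  obtain u v where uv: "(u, v) \<in> ?X" and nn: "\<And>x. 0 \<le> u x" "\<And>x. 0 \<le> v x"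
    and D: "\<bar>u x1\<bar> powr \<alpha> p * \<bar>v x2\<bar> powr \<beta> p = 1" and L: "?L = ?Q u v"
    by (rule Lambda1_minimizer[OF \<Omega> assms(5,6) st ps pt, of \<alpha> \<beta>]) (use p ab in auto)
  have u: "u \<in> frac_sobolev0_cont s p \<Omega>" and v: "v \<in> frac_sobolev0_cont t p \<Omega>"
    and nz: "u x1 \<noteq> 0" "v x2 \<noteq> 0"
    using uv by (auto simp: X_star_def X_space_def)
  \<comment> \<open>With the values at x1 and x2 fixed the denominator stays 1, so changing one
    component at a time compares single energies.\<close>
  have Q: "?Q w z = (enn2real (gagliardo_pow s p w) + enn2real (gagliardo_pow t p z)) / p"
    if "w x1 = u x1" "z x2 = v x2" for w z
    unfolding Q_quot_def that D by (simp add: add_divide_distrib)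
  have "0 < enn2real (gagliardo_pow s p u)"
    using p by (intro frac_sobolev0_cont_pos[OF u \<Omega>(2) st(1) ps _ nz(1)]) simp
  then have Lpos: "0 < ?L"
    unfolding L Q[of u v, OF refl refl] using p by (intro divide_pos_pos add_pos_nonneg) auto
  have up: "0 < u x" if "x \<in> \<Omega>" for x
  proof (rule frac_sobolev0_minimizer_pos[OF \<Omega> st(1,2) p u nn(1) nz(1) _ that])
    fix w assume w: "w \<in> frac_sobolev0_cont s p \<Omega>" "w x1 = u x1"
    then have "(w, v) \<in> ?X" using v nz by (simp add: X_star_def X_space_def)
    then have "?Q u v \<le> ?Q w v" unfolding L[symmetric] using p by (intro Lambda1_le) auto
    then show "enn2real (gagliardo_pow s p u) \<le> enn2real (gagliardo_pow s p w)"
      using w p by (simp add: Q divide_le_cancel)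
  qed
  have vp: "0 < v x" if "x \<in> \<Omega>" for x
  proof (rule frac_sobolev0_minimizer_pos[OF \<Omega> st(3,4) p v nn(2) nz(2) _ that])
    fix w assume w: "w \<in> frac_sobolev0_cont t p \<Omega>" "w x2 = v x2"
    then have "(u, w) \<in> ?X" using u nz by (simp add: X_star_def X_space_def)
    then have "?Q u v \<le> ?Q u w" unfolding L[symmetric] using p by (intro Lambda1_le) auto
    then show "enn2real (gagliardo_pow t p v) \<le> enn2real (gagliardo_pow t p w)"
      using w p by (simp add: Q divide_le_cancel)
  qed
  show "?L > 0 \<and> (\<exists>u v. (u, v) \<in> ?X \<and> (\<forall>x\<in>\<Omega>. u x > 0) \<and> (\<forall>x\<in>\<Omega>. v x > 0) \<and>
     \<bar>u x1\<bar> powr \<alpha> p * \<bar>v x2\<bar> powr \<beta> p = 1 \<and> ?L = ?Q u v)"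
    using Lpos uv up vp D L by blast
qed

end
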